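(* Let $S$ be a semigroup with a completely simple ideal $K$. (1) $S$ is solvable if and only if $S$ is a nilpotent extension of $K$ and every subgroup of $K$ is solvable. (2) The following are equivalent: $S$ is left nilpotent; $S$ is right nilpotent; $S$ is supernilpotent; $S$ is a nilpotent extension of $K$ and every subgroup of $K$ is nilpotent.
   Context: A semigroup is regarded as an algebra with one binary operation. For an algebra $\mathbf A$, $n\ge 1$ and congruences $\alpha_1,\dots,\alpha_n$, let $M_{\mathbf A}(\alpha_1,\dots,\alpha_n)$ be the subalgebra of $\mathbf A^{\{0,1\}^n}$ (functions $\{0,1\}^n\to A$, operations pointwise) generated by all functions $g$ for which there are $i\in\{1,\dots,n\}$ and $(a,b)\in\alpha_i$ with $g(x_1,\dots,x_n)=a$ if $x_i=0$ and $=b$ if $x_i=1$. The $n$-ary (term condition) commutator $[\alpha_1,\dots,\alpha_n]$ is the smallest congruence $\delta$ of $\mathbf A$ such that every $f\in M_{\mathbf A}(\alpha_1,\dots,\alpha_n)$ satisfies: if $(f(x0),f(x1))\in\delta$ for all $x\in\{0,1\}^{n-1}\setminus\{(1,\dots,1)\}$, then $(f(1,\dots,1,0),f(1,\dots,1,1))\in\delta$ (here $x0,x1$ denote $x$ with $0$, resp. $1$, appended). For $n=2$ this is the binary commutator $[\alpha,\beta]$. Let $1$ denote the total congruence $A^2$ and $0$ the equality relation. Define $[1]^0=1$, $[1]^{k+1}=[[1]^k,[1]^k]$; $(1]^1=1$, $(1]^{k+1}=[1,(1]^k]$; $[1)^1=1$, $[1)^{k+1}=[[1)^k,1]$. For $d\in\mathbb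 N=\{0,1,\dots\}$, $\mathbf A$ is $d$-solvable if $[1]^d=0$, left $d$-nilpotent if $(1]^{d+1}=0$, right $d$-nilpotent if $[1)^{d+1}=0$, $d$-supernilpotent if the $(d+1)$-ary commutator $[1,\dots,1]=0$; it is solvable (left nilpotent, right nilpotent, supernilpotent) if this holds for some $d$. For a semigroup $S$ and $m\ge1$, $S^m=\{a_1\cdots a_m: a_i\in S\}$. $S$ is a nilpotent extension of an ideal $K$ if $S^m\subseteq K$ for some $m\ge 1$. Solvability/nilpotence of groups is in the classical group-theoretic sense. *)

theory Defs
  imports "HOL-Algebra.Solvable_Groups"
begin

definition sg_congruence :: "('a::semigroup_mult) rel \<Rightarrow> bool" where
  "sg_congruence \<theta> \<longleftrightarrow> equiv UNIV \<theta> \<and>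
     (\<forall>a b c d. (a, b) \<in> \<theta> \<longrightarrow> (c, d) \<in> \<theta> \<longrightarrow> (a * c, b * d) \<in> \<theta>)"

text \<open>M_A(alpha_1,...,alpha_n): subalgebra of A^({0,1}^n) generated by the generators.
  Elements of {0,1}^n are boolean lists of length n (only those values matter);
  index i ranges over 0..n-1 (corresponding to 1..n in the paper).\<close>

inductive_set Mgen :: "('a::semigroup_mult) rel list \<Rightarrow> (bool list \<Rightarrow> 'a) set"
  for as :: "'a rel list" where
  gen: "\<lbrakk> i < length as; (a, b) \<in> as ! i \<rbrakk>
        \<Longrightarrow> (\<lambda>x. if x ! i then b else a) \<in> Mgen as"
| mult: "\<lbrakk> f \<in> Mgen as; g \<in> Mgen as \<rbrakk> \<Longrightarrow> (\<lambda>x. f x * g x) \<in> Mgen as"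

definition TC_holds :: "('a::semigroup_mult) rel list \<Rightarrow> 'a rel \<Rightarrow> bool" where
  "TC_holds as \<delta> \<longleftrightarrow> (\<forall>f \<in> Mgen as.
     (\<forall>x. length x = length as - 1 \<and> x \<noteq> replicate (length as - 1) True \<longrightarrow>
          (f (x @ [False]), f (x @ [True])) \<in> \<delta>) \<longrightarrow>
     (f (replicate (length as - 1) True @ [False]),
      f (replicate (length as - 1) True @ [True])) \<in> \<delta>)"

definition commutator :: "('a::semigroup_mult) rel list \<Rightarrow> 'a rel" where
  "commutator as = \<Inter>{\<delta>. sg_congruence \<delta> \<and> TC_holds as \<delta>}"

abbreviation bcomm :: "('a::semigroup_mult) rel \<Rightarrow> 'a rel \<Rightarrow> 'a rel" where
  "bcomm \<alpha> \<beta> \<equiv> commutator [\<alpha>, \<beta>]"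

fun derived_pow :: "nat \<Rightarrow> ('a::semigroup_mult) rel" where
  "derived_pow 0 = UNIV"
| "derived_pow (Suc k) = bcomm (derived_pow k) (derived_pow k)"

fun left_pow :: "nat \<Rightarrow> ('a::semigroup_mult) rel" where
  "left_pow 0 = UNIV"   (* unused; index starts at 1 *)
| "left_pow (Suc 0) = UNIV"
| "left_pow (Suc (Suc k)) = bcomm UNIV (left_pow (Suc k))"

fun right_pow :: "nat \<Rightarrow> ('a::semigroup_mult) rel" where
  "right_pow 0 = UNIV"  (* unused; index starts at 1 *)
| "right_pow (Suc 0) = UNIV"
| "right_pow (Suc (Suc k)) = bcomm (right_pow (Suc k)) UNIV"

definition sg_solvable :: "'a::semigroup_mult itself \<Rightarrow> bool" where
  "sg_solvable _ \<longleftrightarrow> (\<exists>d. (derived_pow d :: 'a rel) = Id)"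

definition sg_left_nilpotent :: "'a::semigroup_mult itself \<Rightarrow> bool" where
  "sg_left_nilpotent _ \<longleftrightarrow> (\<exists>d. (left_pow (Suc d) :: 'a rel) = Id)"

definition sg_right_nilpotent :: "'a::semigroup_mult itself \<Rightarrow> bool" where
  "sg_right_nilpotent _ \<longleftrightarrow> (\<exists>d. (right_pow (Suc d) :: 'a rel) = Id)"

definition sg_supernilpotent :: "'a::semigroup_mult itself \<Rightarrow> bool" where
  "sg_supernilpotent _ \<longleftrightarrow>
     (\<exists>d. (commutator (replicate (Suc d) UNIV) :: 'a rel) = Id)"

definition sg_ideal :: "('a::semigroup_mult) set \<Rightarrow> bool" where
  "sg_ideal K \<longleftrightarrow> K \<noteq> {} \<and> (\<forall>s k. k \<in> K \<longrightarrow> s * k \<in> K \<and> k * s \<in> K)"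

definition ideal_of :: "('a::semigroup_mult) set \<Rightarrow> 'a set \<Rightarrow> bool" where
  "ideal_of K I \<longleftrightarrow> I \<noteq> {} \<and> I \<subseteq> K \<and> (\<forall>s\<in>K. \<forall>k\<in>I. s * k \<in> I \<and> k * s \<in> I)"

definition idempotent :: "'a::semigroup_mult \<Rightarrow> bool" where
  "idempotent e \<longleftrightarrow> e * e = e"

text \<open>Completely simple: a simple semigroup (no proper ideals) containing a
  primitive idempotent (an idempotent minimal w.r.t. the natural partial order
  f \<le> e iff f = e f = f e, among idempotents of K).\<close>
definition completely_simple :: "('a::semigroup_mult) set \<Rightarrow> bool" where
  "completely_simple K \<longleftrightarrow> K \<noteq> {} \<and> (\<forall>a\<in>K. \<forall>b\<in>K. a * b \<in> K) \<and>
     (\<forall>I. ideal_of K I \<longrightarrow> I = K) \<and>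
     (\<exists>e\<in>K. idempotent e \<and>
        (\<forall>f\<in>K. idempotent f \<and> f = e * f \<and> f = f * e \<longrightarrow> f = e))"

fun sg_power :: "nat \<Rightarrow> ('a::semigroup_mult) set" where
  "sg_power 0 = UNIV"   (* unused; m \<ge> 1 *)
| "sg_power (Suc 0) = UNIV"
| "sg_power (Suc (Suc m)) = {a * b | a b. a \<in> sg_power (Suc m)}"

definition nilpotent_extension :: "('a::semigroup_mult) set \<Rightarrow> bool" where
  "nilpotent_extension K \<longleftrightarrow> (\<exists>m\<ge>1. sg_power m \<subseteq> K)"

text \<open>A subgroup of K: a subset H of K that is a group under the semigroup
  multiplication (with some identity e).\<close>
definition sub_group_monoid :: "('a::semigroup_mult) set \<Rightarrow> 'a \<Rightarrow> 'a monoid" where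
  "sub_group_monoid H e = \<lparr>carrier = H, mult = (\<lambda>x y. x * y), one = e\<rparr>"

fun lower_central :: "('a, 'b) monoid_scheme \<Rightarrow> nat \<Rightarrow> 'a set" where
  "lower_central G 0 = carrier G"
| "lower_central G (Suc k) = generate G
     (\<Union>g \<in> carrier G. \<Union>h \<in> lower_central G k.
        { g \<otimes>\<^bsub>G\<^esub> h \<otimes>\<^bsub>G\<^esub> inv\<^bsub>G\<^esub> g \<otimes>\<^bsub>G\<^esub> inv\<^bsub>G\<^esub> h })"

definition nilpotent_group :: "('a, 'b) monoid_scheme \<Rightarrow> bool" where
  "nilpotent_group G \<longleftrightarrow> (\<exists>k. lower_central G k = {\<one>\<^bsub>G\<^esub>})"

end

theory Submission
  imports Defs
begin

text \<open>
  Fix a primitive idempotent \<open>e\<close> of \<open>K\<close>. Then \<open>e S e\<close> is a group, and an element \<open>w\<close> of \<open>K\<close> is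
  determined by its Rees coordinates: its \<open>\<R>\<close>-class, its \<open>\<L>\<close>-class and \<open>e w e\<close>.

  Sufficiency: the powers of \<open>S\<close> give a central chain of Rees congruences down to \<open>K\<close>; products of
  many elements act on \<open>K/\<R>\<close> and \<open>K/\<L>\<close> by constant maps, which gives a central chain from \<open>K\<close> to
  the \<open>\<H>\<close>-classes; below that, a normal series of the group \<open>e S e\<close> takes over. For
  supernilpotence, \<open>X \<mapsto> e F(X) e\<close> is a product of group-valued functions each depending on boundedly
  many coordinates, because the \<open>\<R>\<close>- and \<open>\<L>\<close>-class of a long product only depend on its first and
  last few factors. In a nilpotent group, if the derivative of such a function in one direction of a
  large cube is trivial off the top vertex, then it is trivial there too.

  Necessity: if \<open>a'\<close>, \<open>b'\<close> lie in \<open>K\<close> and \<open>f\<close> in \<open>K\<close> satisfies \<open>a' f = a'\<close>, \<open>f b' = b'\<close>, then the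
  term condition for \<open>a' (f b) = a' b\<close> relates \<open>a b\<close> to \<open>a f b \<in> K\<close>; hence long products are related
  to elements of \<open>K\<close> by the iterated commutators. For subgroups, group commutators are terms.
\<close>

subsection \<open>Congruences and commutators\<close>

lemma sg_congruenceI:
  assumes "\<And>a. (a, a) \<in> \<theta>"
    and "\<And>a b. (a, b) \<in> \<theta> \<Longrightarrow> (b, a) \<in> \<theta>"
    and "\<And>a b c. (a, b) \<in> \<theta> \<Longrightarrow> (b, c) \<in> \<theta> \<Longrightarrow> (a, c) \<in> \<theta>"
    and left: "\<And>a b s. (a, b) \<in> \<theta> \<Longrightarrow> (s * a, s * b) \<in> \<theta>"
    and right: "\<And>a b s. (a, b) \<in> \<theta> \<Longrightarrow> (a * s, b * s) \<in> \<theta>"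
  shows "sg_congruence \<theta>"
  unfolding sg_congruence_def
proof (intro conjI allI impI)
  show "equiv UNIV \<theta>"
    by (intro equivI refl_onI symI transI) (auto intro: assms(1) elim: assms(2,3))
  show "(a * c, b * d) \<in> \<theta>" if "(a, b) \<in> \<theta>" "(c, d) \<in> \<theta>" for a b c d
    using assms(3)[OF right[OF that(1)] left[OF that(2)]] .
qed

lemma sg_congruence_refl: "sg_congruence \<theta> \<Longrightarrow> (a, a) \<in> \<theta>"
  by (simp add: sg_congruence_def equiv_def refl_on_def)

lemma sg_congruence_sym: "sg_congruence \<theta> \<Longrightarrow> (a, b) \<in> \<theta> \<Longrightarrow> (b, a) \<in> \<theta>"
  unfolding sg_congruence_def by (meson equivE symE)

lemma sg_congruence_trans:
  "sg_congruence \<theta> \<Longrightarrow> (a, b) \<in> \<theta> \<Longrightarrow> (b, c) \<in> \<theta> \<Longrightarrow> (a, c) \<in> \<theta>"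
  unfolding sg_congruence_def by (meson equivE transE)

lemma sg_congruence_mult:
  "sg_congruence \<theta> \<Longrightarrow> (a, b) \<in> \<theta> \<Longrightarrow> (c, d) \<in> \<theta> \<Longrightarrow> (a * c, b * d) \<in> \<theta>"
  unfolding sg_congruence_def by blast

lemma sg_congruence_mult_left: "sg_congruence \<theta> \<Longrightarrow> (a, b) \<in> \<theta> \<Longrightarrow> (s * a, s * b) \<in> \<theta>"
  by (blast intro: sg_congruence_mult sg_congruence_refl)

lemma sg_congruence_mult_right: "sg_congruence \<theta> \<Longrightarrow> (a, b) \<in> \<theta> \<Longrightarrow> (a * s, b * s) \<in> \<theta>"
  by (blast intro: sg_congruence_mult sg_congruence_refl)

lemma sg_congruence_transfer:
  assumes "sg_congruence \<theta>" "(a, c) \<in> \<theta>" "(b, d) \<in> \<theta>" "(a, b) \<in> \<theta>"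
  shows "(c, d) \<in> \<theta>"
  using assms sg_congruence_sym sg_congruence_trans by metis

lemma sg_congruence_UNIV: "sg_congruence UNIV"
  by (rule sg_congruenceI) auto

lemma sg_congruence_Id: "sg_congruence Id"
  by (rule sg_congruenceI) auto

lemma sg_congruence_Inter:
  assumes "\<And>\<theta>. \<theta> \<in> T \<Longrightarrow> sg_congruence \<theta>" shows "sg_congruence (\<Inter>T)"
proof (rule sg_congruenceI)
  fix a b s
  show "(a, a) \<in> \<Inter>T" using assms sg_congruence_refl by blast
  assume "(a, b) \<in> \<Inter>T"
  then have ab: "(a, b) \<in> \<theta>" if "\<theta> \<in> T" for \<theta> using that by blast
  show "(b, a) \<in> \<Inter>T" using assms ab sg_congruence_sym by blast
  show "(s * a, s * b) \<in> \<Inter>T" using assms ab sg_congruence_mult_left by blast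
  show "(a * s, b * s) \<in> \<Inter>T" using assms ab sg_congruence_mult_right by blast
next
  fix a b c assume "(a, b) \<in> \<Inter>T" "(b, c) \<in> \<Inter>T"
  then have "(a, b) \<in> \<theta> \<and> (b, c) \<in> \<theta>" if "\<theta> \<in> T" for \<theta> using that by blast
  then show "(a, c) \<in> \<Inter>T" using assms sg_congruence_trans by blast
qed

lemma sg_congruence_commutator: "sg_congruence (commutator as)"
  unfolding commutator_def by (rule sg_congruence_Inter) simp

lemma TC_holds_commutator: "TC_holds as (commutator as)"
  unfolding commutator_def TC_holds_def by blast

lemma commutator_subset: "sg_congruence \<delta> \<Longrightarrow> TC_holds as \<delta> \<Longrightarrow> commutator as \<subseteq> \<delta>"
  unfolding commutator_def by blast

lemma sg_congruence_eq_IdI: "sg_congruence \<theta> \<Longrightarrow> \<theta> \<subseteq> Id \<Longrightarrow> \<theta> = Id"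
  using sg_congruence_refl by auto

lemma commutator_eq_Id_iff: "commutator as = Id \<longleftrightarrow> TC_holds as Id"
  using TC_holds_commutator[of as] commutator_subset[OF sg_congruence_Id, of as]
    sg_congruence_eq_IdI[OF sg_congruence_commutator, of as] by auto

subsection \<open>The binary commutator\<close>

text \<open>The arguments \<open>a\<close>, \<open>b\<close>, \<open>c\<close>, \<open>d\<close> are the values at \<open>00\<close>, \<open>01\<close>, \<open>10\<close>, \<open>11\<close> of an element of
  \<open>M(\<alpha>, \<beta>)\<close>.\<close>

inductive commutator_matrix ::
  "('a::semigroup_mult) rel \<Rightarrow> 'a rel \<Rightarrow> 'a \<Rightarrow> 'a \<Rightarrow> 'a \<Rightarrow> 'a \<Rightarrow> bool"
  for \<alpha> \<beta> :: "'a rel" where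
  constant_rows: "(a, b) \<in> \<alpha> \<Longrightarrow> commutator_matrix \<alpha> \<beta> a a b b"
| constant_columns: "(a, b) \<in> \<beta> \<Longrightarrow> commutator_matrix \<alpha> \<beta> a b a b"
| mult: "commutator_matrix \<alpha> \<beta> a b c d \<Longrightarrow> commutator_matrix \<alpha> \<beta> a' b' c' d' \<Longrightarrow>
    commutator_matrix \<alpha> \<beta> (a * a') (b * b') (c * c') (d * d')"

lemma commutator_matrix_if_Mgen:
  assumes "f \<in> Mgen [\<alpha>, \<beta>]"
  shows "commutator_matrix \<alpha> \<beta>
    (f [False, False]) (f [False, True]) (f [True, False]) (f [True, True])"
  using assms
proof (induction rule: Mgen.induct)
  case (gen i a b)
  then consider "i = 0" "(a, b) \<in> \<alpha>" | "i = 1" "(a, b) \<in> \<beta>"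
    by (auto simp: less_Suc_eq)
  then show ?case by cases (auto intro: commutator_matrix.intros)
next
  case (mult f g)
  then show ?case by (auto intro: commutator_matrix.intros)
qed

lemma Mgen_if_commutator_matrix:
  assumes "commutator_matrix \<alpha> \<beta> a b c d"
  shows "\<exists>f \<in> Mgen [\<alpha>, \<beta>]. f [False, False] = a \<and> f [False, True] = b \<and>
    f [True, False] = c \<and> f [True, True] = d"
  using assms
proof induction
  case (constant_rows a b)
  then show ?case
    using Mgen.gen[of 0 "[\<alpha>, \<beta>]" a b] by (intro bexI[of _ "\<lambda>x. if x ! 0 then b else a"]) auto
next
  case (constant_columns a b)
  then show ?case
    using Mgen.gen[of 1 "[\<alpha>, \<beta>]" a b] by (intro bexI[of _ "\<lambda>x. if x ! 1 then b else a"]) auto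
next
  case (mult a b c d a' b' c' d')
  then obtain f g where "f \<in> Mgen [\<alpha>, \<beta>]" "g \<in> Mgen [\<alpha>, \<beta>]" and
    "f [False, False] = a" "f [False, True] = b" "f [True, False] = c" "f [True, True] = d"
    "g [False, False] = a'" "g [False, True] = b'" "g [True, False] = c'" "g [True, True] = d'"
    by blast
  then show ?case
    using Mgen.mult[of f "[\<alpha>, \<beta>]" g] by (intro bexI[of _ "\<lambda>x. f x * g x"]) auto
qed

lemma TC_holds_binary_iff:
  "TC_holds [\<alpha>, \<beta>] \<delta> \<longleftrightarrow>
    (\<forall>a b c d. commutator_matrix \<alpha> \<beta> a b c d \<longrightarrow> (a, b) \<in> \<delta> \<longrightarrow> (c, d) \<in> \<delta>)"
proof -
  have "length x = Suc 0 \<and> x \<noteq> [True] \<longleftrightarrow> x = [False]" for x :: "bool list"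
    by (cases x) auto
  then have "TC_holds [\<alpha>, \<beta>] \<delta> \<longleftrightarrow> (\<forall>f \<in> Mgen [\<alpha>, \<beta>].
    (f [False, False], f [False, True]) \<in> \<delta> \<longrightarrow> (f [True, False], f [True, True]) \<in> \<delta>)"
    unfolding TC_holds_def by simp
  also have "\<dots> \<longleftrightarrow>
    (\<forall>a b c d. commutator_matrix \<alpha> \<beta> a b c d \<longrightarrow> (a, b) \<in> \<delta> \<longrightarrow> (c, d) \<in> \<delta>)"
    using commutator_matrix_if_Mgen Mgen_if_commutator_matrix by metis
  finally show ?thesis .
qed

lemma commutator_matrix_mono:
  "commutator_matrix \<alpha> \<beta> a b c d \<Longrightarrow> \<alpha> \<subseteq> \<alpha>' \<Longrightarrow> \<beta> \<subseteq> \<beta>' \<Longrightarrow>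
    commutator_matrix \<alpha>' \<beta>' a b c d"
  by (induction rule: commutator_matrix.induct) (auto intro: commutator_matrix.intros)

lemma commutator_matrix_transpose:
  "commutator_matrix \<alpha> \<beta> a b c d \<Longrightarrow> commutator_matrix \<beta> \<alpha> a c b d"
  by (induction rule: commutator_matrix.induct) (auto intro: commutator_matrix.intros)

lemma commutator_matrix_rows:
  assumes "commutator_matrix \<alpha> \<beta> a b c d" "sg_congruence \<beta>"
  shows "(a, b) \<in> \<beta>" and "(c, d) \<in> \<beta>"
  using assms
  by (induction rule: commutator_matrix.induct) (auto intro: sg_congruence_refl sg_congruence_mult)

lemmas commutator_matrix_columns = commutator_matrix_rows[OF commutator_matrix_transpose]

lemma bcomm_commutator_matrix:
  "commutator_matrix \<alpha> \<beta> a b c d \<Longrightarrow> (a, b) \<in> bcomm \<alpha> \<beta> \<Longrightarrow> (c, d) \<in> bcomm \<alpha> \<beta>"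
  using TC_holds_commutator TC_holds_binary_iff by blast

lemma TC_holds_antimono:
  "TC_holds [\<alpha>', \<beta>'] \<delta> \<Longrightarrow> \<alpha> \<subseteq> \<alpha>' \<Longrightarrow> \<beta> \<subseteq> \<beta>' \<Longrightarrow> TC_holds [\<alpha>, \<beta>] \<delta>"
  unfolding TC_holds_binary_iff using commutator_matrix_mono by blast

lemma bcomm_mono: "\<alpha> \<subseteq> \<alpha>' \<Longrightarrow> \<beta> \<subseteq> \<beta>' \<Longrightarrow> bcomm \<alpha> \<beta> \<subseteq> bcomm \<alpha>' \<beta>'"
  by (rule commutator_subset[OF sg_congruence_commutator TC_holds_antimono[OF TC_holds_commutator]])

lemma bcomm_subset_right:
  assumes "sg_congruence \<beta>" shows "bcomm \<alpha> \<beta> \<subseteq> \<beta>"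
  using commutator_matrix_rows(2)[OF _ assms]
  by (intro commutator_subset assms) (auto simp: TC_holds_binary_iff)

lemma bcomm_subset_left:
  assumes "sg_congruence \<alpha>" shows "bcomm \<alpha> \<beta> \<subseteq> \<alpha>"
proof (rule commutator_subset[OF assms])
  show "TC_holds [\<alpha>, \<beta>] \<alpha>"
    unfolding TC_holds_binary_iff
    using commutator_matrix_columns[OF _ assms] sg_congruence_transfer[OF assms] by blast
qed

subsection \<open>Central series\<close>

definition central_series :: "(nat \<Rightarrow> ('a::semigroup_mult) rel) \<Rightarrow> bool" where
  "central_series P \<longleftrightarrow> P 0 = UNIV \<and>
     (\<forall>k. P (Suc k) = bcomm UNIV (P k) \<or> P (Suc k) = bcomm (P k) UNIV)"

lemma central_series_left_pow: "central_series (\<lambda>d. left_pow (Suc d))"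
  by (simp add: central_series_def)

lemma central_series_right_pow: "central_series (\<lambda>d. right_pow (Suc d))"
  by (simp add: central_series_def)

inductive iterated_commutator :: "('a::semigroup_mult) rel \<Rightarrow> bool" where
  UNIV: "iterated_commutator UNIV"
| bcomm: "iterated_commutator \<alpha> \<Longrightarrow> iterated_commutator \<beta> \<Longrightarrow> iterated_commutator (bcomm \<alpha> \<beta>)"

lemma sg_congruence_iterated_commutator: "iterated_commutator \<alpha> \<Longrightarrow> sg_congruence \<alpha>"
  by (induction rule: iterated_commutator.induct)
    (simp_all add: sg_congruence_UNIV sg_congruence_commutator)

lemma iterated_commutator_derived_pow: "iterated_commutator (derived_pow d)"
  by (induction d) (simp_all add: iterated_commutator.intros)

lemma iterated_commutator_central_series:
  assumes "central_series P" shows "iterated_commutator (P k)"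
proof (induction k)
  case 0
  then show ?case using assms iterated_commutator.UNIV by (simp add: central_series_def)
next
  case (Suc k)
  have "P (Suc k) = bcomm UNIV (P k) \<or> P (Suc k) = bcomm (P k) UNIV"
    using assms by (simp add: central_series_def)
  then show ?case using Suc iterated_commutator.intros by metis
qed

lemmas sg_congruence_derived_pow =
    sg_congruence_iterated_commutator[OF iterated_commutator_derived_pow]
  and sg_congruence_central_series =
    sg_congruence_iterated_commutator[OF iterated_commutator_central_series]

lemma central_series_antimono:
  assumes "central_series P" shows "antimono P"
  unfolding antimono_iff_le_Suc
proof
  fix k
  have "sg_congruence (P k)" using assms by (rule sg_congruence_central_series)
  moreover have "P (Suc k) = bcomm UNIV (P k) \<or> P (Suc k) = bcomm (P k) UNIV"
    using assms by (simp add: central_series_def)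
  ultimately show "P (Suc k) \<le> P k" using bcomm_subset_left bcomm_subset_right by metis
qed

lemma derived_pow_subset_left_pow: "derived_pow d \<subseteq> left_pow (Suc d)"
proof (induction d)
  case (Suc d)
  then show ?case using bcomm_mono[of "derived_pow d" UNIV] by simp
qed simp

definition nilpotent_modulo :: "('a::semigroup_mult) rel \<Rightarrow> bool" where
  "nilpotent_modulo \<alpha> \<longleftrightarrow> (\<forall>P. central_series P \<longrightarrow> (\<exists>d. P d \<subseteq> \<alpha>))"

lemma nilpotent_modulo_UNIV: "nilpotent_modulo UNIV"
  unfolding nilpotent_modulo_def by auto

lemma nilpotent_modulo_mono: "nilpotent_modulo \<alpha> \<Longrightarrow> \<alpha> \<subseteq> \<beta> \<Longrightarrow> nilpotent_modulo \<beta>"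
  unfolding nilpotent_modulo_def by blast

lemma nilpotent_modulo_Int:
  assumes "nilpotent_modulo \<alpha>" "nilpotent_modulo \<beta>" shows "nilpotent_modulo (\<alpha> \<inter> \<beta>)"
  unfolding nilpotent_modulo_def
proof (intro allI impI)
  fix P :: "nat \<Rightarrow> 'a rel" assume P: "central_series P"
  obtain i j where "P i \<subseteq> \<alpha>" "P j \<subseteq> \<beta>"
    using assms P unfolding nilpotent_modulo_def by blast
  moreover have "P (max i j) \<subseteq> P i" "P (max i j) \<subseteq> P j"
    using antimonoD[OF central_series_antimono[OF P]] by simp_all
  ultimately show "\<exists>d. P d \<subseteq> \<alpha> \<inter> \<beta>" by blast
qed

lemma nilpotent_modulo_derived_pow:
  "nilpotent_modulo \<alpha> \<Longrightarrow> \<exists>d. derived_pow d \<subseteq> \<alpha>"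
  unfolding nilpotent_modulo_def
  using central_series_left_pow derived_pow_subset_left_pow subset_trans by metis

definition central_step :: "('a::semigroup_mult) rel \<Rightarrow> 'a rel \<Rightarrow> bool" where
  "central_step \<alpha> \<delta> \<longleftrightarrow>
     sg_congruence \<delta> \<and> TC_holds [UNIV, \<alpha>] \<delta> \<and> TC_holds [\<alpha>, UNIV] \<delta>"

lemma nilpotent_modulo_step:
  assumes "nilpotent_modulo \<alpha>" "central_step \<alpha> \<delta>" shows "nilpotent_modulo \<delta>"
  unfolding nilpotent_modulo_def
proof (intro allI impI)
  fix P :: "nat \<Rightarrow> 'a rel" assume P: "central_series P"
  then obtain d where d: "P d \<subseteq> \<alpha>" using assms(1) unfolding nilpotent_modulo_def by blast
  have "bcomm UNIV \<alpha> \<subseteq> \<delta>" "bcomm \<alpha> UNIV \<subseteq> \<delta>"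
    using assms(2) commutator_subset unfolding central_step_def by blast+
  then have "bcomm UNIV (P d) \<subseteq> \<delta>" "bcomm (P d) UNIV \<subseteq> \<delta>"
    using bcomm_mono[of UNIV UNIV "P d" \<alpha>] bcomm_mono[of "P d" \<alpha> UNIV UNIV] d by auto
  moreover have "P (Suc d) = bcomm UNIV (P d) \<or> P (Suc d) = bcomm (P d) UNIV"
    using P by (simp add: central_series_def)
  ultimately show "\<exists>d. P d \<subseteq> \<delta>" by metis
qed

lemma central_stepI:
  assumes \<delta>: "sg_congruence \<delta>"
    and matrix: "\<And>a b c d. commutator_matrix UNIV \<alpha> a b c d \<Longrightarrow>
      (a, b) \<in> \<delta> \<and> (c, d) \<in> \<delta> \<or> (a, c) \<in> \<delta> \<and> (b, d) \<in> \<delta>"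
  shows "central_step \<alpha> \<delta>"
  unfolding central_step_def TC_holds_binary_iff
proof (intro conjI allI impI \<delta>)
  fix a b c d assume "(a, b) \<in> \<delta>"
  then show "(c, d) \<in> \<delta>" if "commutator_matrix UNIV \<alpha> a b c d"
    using matrix[OF that] sg_congruence_transfer[OF \<delta>] by blast
  show "(c, d) \<in> \<delta>" if "commutator_matrix \<alpha> UNIV a b c d"
    using matrix[OF commutator_matrix_transpose[OF that]] \<open>(a, b) \<in> \<delta>\<close>
      sg_congruence_transfer[OF \<delta>] by blast
qed

lemma central_step_two_sided:
  assumes \<alpha>: "sg_congruence \<alpha>" and \<delta>: "sg_congruence \<delta>"
    and left: "\<And>a b s. (a, b) \<in> \<alpha> \<Longrightarrow> (s * a, s * b) \<in> \<delta>"
    and right: "\<And>a b s. (a, b) \<in> \<alpha> \<Longrightarrow> (a * s, b * s) \<in> \<delta>"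
  shows "central_step \<alpha> \<delta>"
proof (rule central_stepI[OF \<delta>])
  have product: "(a * a', b * b') \<in> \<delta>" if "(a, b) \<in> \<alpha>" "(a', b') \<in> \<alpha>" for a a' b b'
    using sg_congruence_trans[OF \<delta> right[OF that(1)] left[OF that(2)]] .
  show "(a, b) \<in> \<delta> \<and> (c, d) \<in> \<delta> \<or> (a, c) \<in> \<delta> \<and> (b, d) \<in> \<delta>"
    if "commutator_matrix UNIV \<alpha> a b c d" for a b c d
    using that
  proof cases
    case (mult a b c d a' b' c' d')
    then show ?thesis using product commutator_matrix_rows[OF _ \<alpha>] by blast
  qed (simp_all add: sg_congruence_refl[OF \<delta>])
qed

subsection \<open>Powers of a semigroup\<close>

lemma sg_power_mult_right: "a \<in> sg_power k \<Longrightarrow> a * s \<in> sg_power (Suc k)"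
  by (cases k) auto

lemma sg_power_Suc_subset: "sg_power (Suc k) \<subseteq> sg_power k"
proof (induction k)
  case (Suc k)
  then show ?case by (cases k) auto
qed simp

lemma sg_power_mult: "a \<in> sg_power j \<Longrightarrow> b \<in> sg_power k \<Longrightarrow> a * b \<in> sg_power (j + k)"
proof (induction k arbitrary: b)
  case 0
  then show ?case using sg_power_mult_right[of a j b] sg_power_Suc_subset by auto
next
  case (Suc k)
  show ?case
  proof (cases "k = 0")
    case True
    then show ?thesis using sg_power_mult_right[OF Suc.prems(1), of b] by simp
  next
    case False
    then obtain k' where "k = Suc k'" using not0_implies_Suc by blast
    then obtain c d where b: "b = c * d" "c \<in> sg_power k" using Suc.prems(2) by auto
    have "a * c * d \<in> sg_power (Suc (j + k))"
      using Suc.IH[OF Suc.prems(1) b(2)] by (rule sg_power_mult_right)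
    then show ?thesis by (simp add: b(1) mult.assoc)
  qed
qed

lemma sg_power_split:
  "s \<in> sg_power (Suc k + Suc l) \<Longrightarrow> \<exists>a \<in> sg_power (Suc k). \<exists>b \<in> sg_power (Suc l). s = a * b"
proof (induction l arbitrary: s)
  case (Suc l)
  then obtain c d where s: "s = c * d" "c \<in> sg_power (Suc k + Suc l)" by auto
  from Suc.IH[OF s(2)] obtain a b
    where "a \<in> sg_power (Suc k)" "b \<in> sg_power (Suc l)" "c = a * b" by blast
  then show ?case using s(1) sg_power_mult_right[of b "Suc l" d] by (metis mult.assoc)
qed auto

definition rees :: "('a::semigroup_mult) set \<Rightarrow> 'a rel" where
  "rees I = Id \<union> I \<times> I"

lemma sg_congruence_rees:
  assumes "\<And>s k. k \<in> I \<Longrightarrow> s * k \<in> I" "\<And>s k. k \<in> I \<Longrightarrow> k * s \<in> I"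
  shows "sg_congruence (rees I)"
  using assms by (intro sg_congruenceI) (auto simp: rees_def)

lemma nilpotent_modulo_rees_sg_power: "nilpotent_modulo (rees (sg_power k))"
proof (induction k)
  case 0
  then show ?case using nilpotent_modulo_UNIV by (simp add: rees_def nilpotent_modulo_mono)
next
  case (Suc k)
  have step: "s * a \<in> sg_power (Suc k)" "a * s \<in> sg_power (Suc k)"
    if "a \<in> sg_power k" for a s :: 'a and k
    using that sg_power_mult[of s 1 a k] sg_power_mult_right by auto
  have congruence: "sg_congruence (rees (sg_power k :: 'a set))" for k
    by (rule sg_congruence_rees) (use step sg_power_Suc_subset in blast)+
  have "central_step (rees (sg_power k :: 'a set)) (rees (sg_power (Suc k)))"
    by (rule central_step_two_sided[OF congruence congruence])
      (auto simp: rees_def simp del: sg_power.simps intro: step)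
  with Suc.IH show ?case by (rule nilpotent_modulo_step)
qed

subsection \<open>Left-right duality\<close>

text \<open>A semigroup and its opposite have the same congruences, ideals, powers and commutators. Facts
  about \<open>\<cdot>\<close> therefore come in two mirror-image versions, for \<open>a \<cdot> b = a * b\<close> and \<open>a \<cdot> b = b * a\<close>.\<close>

locale orientation =
  fixes op :: "'a::semigroup_mult \<Rightarrow> 'a \<Rightarrow> 'a"  (infixl \<open>\<cdot>\<close> 70)
  assumes orientation: "(\<cdot>) = (*) \<or> (\<cdot>) = (\<lambda>a b. b * a)"
begin

lemma op_assoc: "a \<cdot> b \<cdot> c = a \<cdot> (b \<cdot> c)"
  using orientation by (auto simp: mult.assoc)

lemma sg_ideal_op: "sg_ideal K \<Longrightarrow> k \<in> K \<Longrightarrow> s \<cdot> k \<in> K" "sg_ideal K \<Longrightarrow> k \<in> K \<Longrightarrow> k \<cdot> s \<in> K"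
  using orientation unfolding sg_ideal_def by auto

lemma sg_power_op: "a \<in> sg_power j \<Longrightarrow> b \<in> sg_power k \<Longrightarrow> a \<cdot> b \<in> sg_power (j + k)"
  using orientation sg_power_mult by (metis add.commute)

lemma sg_congruence_opI:
  assumes "\<And>a. (a, a) \<in> \<theta>"
    and "\<And>a b. (a, b) \<in> \<theta> \<Longrightarrow> (b, a) \<in> \<theta>"
    and "\<And>a b c. (a, b) \<in> \<theta> \<Longrightarrow> (b, c) \<in> \<theta> \<Longrightarrow> (a, c) \<in> \<theta>"
    and "\<And>a b s. (a, b) \<in> \<theta> \<Longrightarrow> (s \<cdot> a, s \<cdot> b) \<in> \<theta>"
    and "\<And>a b s. (a, b) \<in> \<theta> \<Longrightarrow> (a \<cdot> s, b \<cdot> s) \<in> \<theta>"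
  shows "sg_congruence \<theta>"
  using orientation
proof
  assume op: "(\<cdot>) = (*)"
  show ?thesis by (rule sg_congruenceI[OF assms(1-3) assms(4,5)[unfolded op]])
next
  assume op: "(\<cdot>) = (\<lambda>a b. b * a)"
  show ?thesis by (rule sg_congruenceI[OF assms(1-3) assms(5,4)[unfolded op]])
qed

lemma sg_congruence_op:
  assumes "sg_congruence \<theta>" "(a, b) \<in> \<theta>"
  shows "(s \<cdot> a, s \<cdot> b) \<in> \<theta>" and "(a \<cdot> s, b \<cdot> s) \<in> \<theta>"
  using orientation sg_congruence_mult_left[OF assms] sg_congruence_mult_right[OF assms] by auto

lemma commutator_matrix_op_induct [consumes 1, case_names constant_rows constant_columns op]:
  assumes "commutator_matrix \<alpha> \<beta> a b c d"
    and "\<And>a b. (a, b) \<in> \<alpha> \<Longrightarrow> Q a a b b"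
    and "\<And>a b. (a, b) \<in> \<beta> \<Longrightarrow> Q a b a b"
    and "\<And>a b c d a' b' c' d'. \<lbrakk>commutator_matrix \<alpha> \<beta> a b c d; commutator_matrix \<alpha> \<beta> a' b' c' d';
      Q a b c d; Q a' b' c' d'\<rbrakk> \<Longrightarrow> Q (a \<cdot> a') (b \<cdot> b') (c \<cdot> c') (d \<cdot> d')"
  shows "Q a b c d"
  using assms(1)
proof induction
  case (mult a b c d a' b' c' d')
  from orientation show ?case
  proof
    assume "(\<cdot>) = (*)"
    then show ?thesis using assms(4)[OF mult(1,2,3,4)] by simp
  next
    assume "(\<cdot>) = (\<lambda>a b. b * a)"
    then show ?thesis using assms(4)[OF mult(2,1,4,3)] by simp
  qed
qed (fact assms(2,3))+

text \<open>A varying factor at the beginning of a product lies in \<open>K\<close> and fixes the \<open>\<delta>\<close>-class of the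
  product; any other varying factor is multiplied from the left, which improves \<open>\<alpha>\<close> to \<open>\<delta>\<close>.\<close>

lemma central_step_one_sided:
  assumes \<alpha>: "sg_congruence \<alpha>" "\<alpha> \<subseteq> rees K" and \<delta>: "sg_congruence \<delta>"
    and absorb: "\<And>k c d. k \<in> K \<Longrightarrow> (k \<cdot> c, k \<cdot> d) \<in> \<delta>"
    and left: "\<And>a b s. (a, b) \<in> \<alpha> \<Longrightarrow> (s \<cdot> a, s \<cdot> b) \<in> \<delta>"
  shows "central_step \<alpha> \<delta>"
proof (rule central_stepI[OF \<delta>])
  define rows where "rows a b c d \<longleftrightarrow> (a, b) \<in> \<delta> \<and> (c, d) \<in> \<delta>" for a b c d
  define columns where "columns a b c d \<longleftrightarrow> (a, c) \<in> \<delta> \<and> (b, d) \<in> \<delta> \<and>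
    (\<forall>s t. (a \<cdot> s, c \<cdot> t) \<in> \<delta> \<and> (b \<cdot> s, d \<cdot> t) \<in> \<delta>)" for a b c d
  have "rows a b c d \<or> columns a b c d" if "commutator_matrix UNIV \<alpha> a b c d" for a b c d
    using that
  proof (induction rule: commutator_matrix_op_induct)
    case (constant_rows a b)
    then show ?case using sg_congruence_refl[OF \<delta>] by (simp add: rows_def)
  next
    case (constant_columns a b)
    then have "a = b \<or> a \<in> K \<and> b \<in> K" using \<alpha>(2) by (auto simp: rees_def)
    then show ?case
      using absorb sg_congruence_refl[OF \<delta>] unfolding rows_def columns_def by blast
  next
    case (op a b c d a' b' c' d')
    from op.IH(1) show ?case
    proof
      assume "rows a b c d"
      then have "(a \<cdot> a', b \<cdot> a') \<in> \<delta>" "(c \<cdot> c', d \<cdot> c') \<in> \<delta>"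
        unfolding rows_def using sg_congruence_op(2)[OF \<delta>] by blast+
      moreover have "(b \<cdot> a', b \<cdot> b') \<in> \<delta>" "(d \<cdot> c', d \<cdot> d') \<in> \<delta>"
        using left commutator_matrix_rows[OF op.hyps(2) \<alpha>(1)] by blast+
      ultimately have "rows (a \<cdot> a') (b \<cdot> b') (c \<cdot> c') (d \<cdot> d')"
        unfolding rows_def using sg_congruence_trans[OF \<delta>] by blast
      then show ?thesis ..
    next
      assume "columns a b c d"
      then have "columns (a \<cdot> a') (b \<cdot> b') (c \<cdot> c') (d \<cdot> d')"
        by (simp add: columns_def op_assoc)
      then show ?thesis ..
    qed
  qed
  then show "(a, b) \<in> \<delta> \<and> (c, d) \<in> \<delta> \<or> (a, c) \<in> \<delta> \<and> (b, d) \<in> \<delta>"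
    if "commutator_matrix UNIV \<alpha> a b c d" for a b c d
    using that unfolding rows_def columns_def by blast
qed

definition translation_kernel :: "'a set \<Rightarrow> 'a rel \<Rightarrow> nat \<Rightarrow> 'a rel" where
  "translation_kernel K \<theta> j = {(a, b) \<in> rees K. \<forall>w \<in> sg_power j. (w \<cdot> a, w \<cdot> b) \<in> \<theta>}"

lemma sg_congruence_translation_kernel:
  assumes K: "sg_ideal K" and \<theta>: "sg_congruence \<theta>"
  shows "sg_congruence (translation_kernel K \<theta> j)"
proof -
  have rees: "sg_congruence (rees K)"
    using K by (intro sg_congruence_rees) (auto simp: sg_ideal_def)
  have power: "w \<cdot> s \<in> sg_power j" if "w \<in> sg_power j" for w s
    using sg_power_op[OF that, of s 0] by simp
  show ?thesis
  proof (rule sg_congruence_opI)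
    fix a b s assume ab: "(a, b) \<in> translation_kernel K \<theta> j"
    then have "(w \<cdot> s \<cdot> a, w \<cdot> s \<cdot> b) \<in> \<theta>" if "w \<in> sg_power j" for w
      using power[OF that, of s] by (simp add: translation_kernel_def)
    then show "(s \<cdot> a, s \<cdot> b) \<in> translation_kernel K \<theta> j"
      using ab sg_congruence_op(1)[OF rees] by (auto simp: translation_kernel_def op_assoc)
    have "(w \<cdot> a \<cdot> s, w \<cdot> b \<cdot> s) \<in> \<theta>" if "w \<in> sg_power j" for w
      using ab that sg_congruence_op(2)[OF \<theta>] by (simp add: translation_kernel_def)
    then show "(a \<cdot> s, b \<cdot> s) \<in> translation_kernel K \<theta> j"
      using ab sg_congruence_op(2)[OF rees] by (auto simp: translation_kernel_def op_assoc)
  next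
    fix a b c assume "(a, b) \<in> translation_kernel K \<theta> j" "(b, c) \<in> translation_kernel K \<theta> j"
    then show "(a, c) \<in> translation_kernel K \<theta> j"
      using sg_congruence_trans[OF rees] sg_congruence_trans[OF \<theta>]
      unfolding translation_kernel_def by blast
  qed (auto simp: translation_kernel_def
      intro: sg_congruence_refl[OF rees] sg_congruence_sym[OF rees]
        sg_congruence_refl[OF \<theta>] sg_congruence_sym[OF \<theta>])
qed

lemma nilpotent_modulo_absorbing:
  assumes K: "sg_ideal K" "nilpotent_extension K" and \<theta>: "sg_congruence \<theta>"
    and absorb: "\<And>k c d. k \<in> K \<Longrightarrow> (k \<cdot> c, k \<cdot> d) \<in> \<theta>"
  shows "nilpotent_modulo \<theta>"
proof -
  let ?T = "translation_kernel K \<theta>"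
  note congruence = sg_congruence_translation_kernel[OF K(1) \<theta>]
  obtain m where m: "sg_power m \<subseteq> K" using K(2) unfolding nilpotent_extension_def by blast
  have "rees (sg_power m) \<subseteq> ?T m"
    using m absorb by (auto simp: rees_def translation_kernel_def intro: sg_congruence_refl[OF \<theta>])
  then have "nilpotent_modulo (?T m)"
    using nilpotent_modulo_mono nilpotent_modulo_rees_sg_power by blast
  moreover have "central_step (?T (Suc j)) (?T j)" for j
  proof (rule central_step_one_sided[OF congruence _ congruence])
    fix a b s assume "(a, b) \<in> ?T (Suc j)"
    moreover have "w \<cdot> s \<in> sg_power (Suc j)" if "w \<in> sg_power j" for w
      using sg_power_op[OF that, of s 1] by simp
    ultimately show "(s \<cdot> a, s \<cdot> b) \<in> ?T j"
      using sg_ideal_op(1)[OF K(1)]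
      by (auto simp: translation_kernel_def rees_def op_assoc[symmetric] simp del: sg_power.simps)
  next
    fix k c d assume "k \<in> K"
    then show "(k \<cdot> c, k \<cdot> d) \<in> ?T j"
      using sg_ideal_op[OF K(1)] absorb
      by (auto simp: translation_kernel_def rees_def op_assoc[symmetric])
  qed (auto simp: translation_kernel_def)
  ultimately have "nilpotent_modulo (?T 0)"
    by (induction m) (use nilpotent_modulo_step in blast)+
  moreover have "central_step (?T 0) \<theta>"
    by (rule central_step_one_sided[OF congruence _ \<theta> absorb]) (auto simp: translation_kernel_def)
  ultimately show ?thesis by (rule nilpotent_modulo_step)
qed

end

text \<open>The abstract form of the \<open>\<R>\<close>-class of an element of \<open>K\<close> (or of its \<open>\<L>\<close>-class, for the opposite
  multiplication).\<close>

locale invariant_coordinate = orientation op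
  for op :: "'a::semigroup_mult \<Rightarrow> 'a \<Rightarrow> 'a"  (infixl \<open>\<cdot>\<close> 70) +
  fixes K :: "'a set" and \<pi> :: "'a \<Rightarrow> 'b"
  assumes ideal: "sg_ideal K"
    and invariant: "k \<in> K \<Longrightarrow> \<pi> (k \<cdot> s) = \<pi> k"
    and transitive: "k \<in> K \<Longrightarrow> l \<in> K \<Longrightarrow> \<pi> k = \<pi> l \<Longrightarrow> \<exists>s. k = l \<cdot> s"
begin

definition same_coordinate :: "'a rel" where
  "same_coordinate = {(a, b) \<in> rees K. \<pi> a = \<pi> b}"

lemma sg_congruence_same_coordinate: "sg_congruence same_coordinate"
proof (rule sg_congruence_opI)
  fix a b s assume ab: "(a, b) \<in> same_coordinate"
  show "(a \<cdot> s, b \<cdot> s) \<in> same_coordinate"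
    using ab invariant sg_ideal_op[OF ideal] by (auto simp: same_coordinate_def rees_def)
  show "(s \<cdot> a, s \<cdot> b) \<in> same_coordinate"
  proof (cases "a = b")
    case False
    with ab have K: "a \<in> K" "b \<in> K" "\<pi> a = \<pi> b" by (auto simp: same_coordinate_def rees_def)
    obtain t where "a = b \<cdot> t" using transitive[OF K] by blast
    then have "\<pi> (s \<cdot> a) = \<pi> (s \<cdot> b)"
      using invariant[of "s \<cdot> b" t] sg_ideal_op[OF ideal K(2)] by (simp add: op_assoc)
    then show ?thesis using K sg_ideal_op[OF ideal] by (simp add: same_coordinate_def rees_def)
  qed (simp add: same_coordinate_def rees_def)
qed (auto simp: same_coordinate_def rees_def)

lemma nilpotent_modulo_same_coordinate:
  assumes "nilpotent_extension K" shows "nilpotent_modulo same_coordinate"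
  using ideal assms sg_congruence_same_coordinate
proof (rule nilpotent_modulo_absorbing)
  show "(k \<cdot> c, k \<cdot> d) \<in> same_coordinate" if "k \<in> K" for k c d
    using that invariant sg_ideal_op[OF ideal] by (simp add: same_coordinate_def rees_def)
qed

end

subsection \<open>Completely simple ideals\<close>

lemma completely_simple_factorization:
  assumes "completely_simple K" "a \<in> K" "b \<in> K"
  shows "\<exists>x \<in> K. \<exists>y \<in> K. b = x * a * y"
proof -
  have closed: "x * y \<in> K" if "x \<in> K" "y \<in> K" for x y
    using assms(1) that unfolding completely_simple_def by blast
  define I where "I = {x * a * y | x y. x \<in> K \<and> y \<in> K}"
  have "ideal_of K I" unfolding ideal_of_def
  proof (intro conjI ballI)
    show "I \<noteq> {}" using assms(2) unfolding I_def by blast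
    show "I \<subseteq> K" using closed assms(2) unfolding I_def by blast
    fix s k assume s: "s \<in> K" and "k \<in> I"
    then obtain x y where k: "k = x * a * y" "x \<in> K" "y \<in> K" unfolding I_def by blast
    have "s * k = (s * x) * a * y" "k * s = x * a * (y * s)" by (simp_all add: k(1) mult.assoc)
    then show "s * k \<in> I" "k * s \<in> I"
      unfolding I_def using closed[OF s k(2)] closed[OF k(3) s] k by blast+
  qed
  then have "I = K" using assms(1) unfolding completely_simple_def by blast
  with assms(3) show ?thesis unfolding I_def by blast
qed

lemma sub_group_monoid_simps [simp]:
  "carrier (sub_group_monoid H e) = H"
  "\<one>\<^bsub>sub_group_monoid H e\<^esub> = e"
  "x \<otimes>\<^bsub>sub_group_monoid H e\<^esub> y = x * y"
  by (simp_all add: sub_group_monoid_def)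

locale completely_simple_ideal =
  fixes K :: "('a::semigroup_mult) set" and e :: 'a
  assumes ideal: "sg_ideal K" and simple: "completely_simple K"
    and e_in_K: "e \<in> K" and e_idem [simp]: "e * e = e"
    and primitive: "f \<in> K \<Longrightarrow> f * f = f \<Longrightarrow> e * f = f \<Longrightarrow> f * e = f \<Longrightarrow> f = e"
begin

lemma K_left: "k \<in> K \<Longrightarrow> s * k \<in> K" and K_right: "k \<in> K \<Longrightarrow> k * s \<in> K"
  using ideal unfolding sg_ideal_def by blast+

lemma e_left_idem [simp]: "e * (e * x) = e * x"
  by (metis e_idem mult.assoc)

definition H :: "'a set" where "H = {a. e * a = a \<and> a * e = a}"

lemma H_iff: "a \<in> H \<longleftrightarrow> e * a = a \<and> a * e = a"
  by (simp add: H_def)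

lemma H_subset_K: "H \<subseteq> K"
proof
  fix a assume "a \<in> H"
  then show "a \<in> K" using K_right[OF e_in_K, of a] by (simp add: H_iff)
qed

lemma sandwich_in_H [simp]: "e * a * e \<in> H"
  by (simp add: H_iff mult.assoc)

abbreviation G :: "'a monoid" where "G \<equiv> sub_group_monoid H e"

lemma H_left_inverse:
  assumes a: "a \<in> H" shows "\<exists>b \<in> H. b * a = e"
proof -
  obtain x0 y0 where factor: "e = x0 * a * y0"
    using completely_simple_factorization[OF simple _ e_in_K] a H_subset_K by blast
  define x y where "x = e * x0 * e" and "y = e * y0 * e"
  have "x * a * y = e * (x0 * (e * a * e) * y0) * e" by (simp add: x_def y_def mult.assoc)
  then have xay: "x * a * y = e" using a factor[symmetric] by (simp add: H_iff)
  have H: "x \<in> H" "y \<in> H" by (simp_all add: x_def y_def)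
  have "y * x * a = e"
  proof (rule primitive)
    show "y * x * a \<in> K" using a H_subset_K K_left by blast
    have "y * x * a * (y * x * a) = y * (x * a * y) * x * a" by (simp add: mult.assoc)
    then show "y * x * a * (y * x * a) = y * x * a" using xay H by (simp add: H_iff)
  qed (use a H in \<open>simp_all add: H_iff mult.assoc[symmetric]\<close>, simp add: mult.assoc)
  moreover have "y * x \<in> H"
    using H by (simp add: H_iff mult.assoc[symmetric]) (simp add: mult.assoc)
  ultimately show ?thesis by blast
qed

lemma group_G: "group G"
proof (rule groupI)
  show "\<exists>y\<in>carrier G. y \<otimes>\<^bsub>G\<^esub> x = \<one>\<^bsub>G\<^esub>" if "x \<in> carrier G" for x
    using that H_left_inverse by simp
qed (auto simp: H_iff mult.assoc[symmetric], simp add: mult.assoc)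

sublocale G: group G by (rule group_G)

lemma H_mult_closed [simp]: "a \<in> H \<Longrightarrow> b \<in> H \<Longrightarrow> a * b \<in> H"
  using G.m_closed[of a b] by simp

definition J :: "'a \<Rightarrow> 'a" where "J a = inv\<^bsub>G\<^esub> (e * a * e)"

lemma J_in_H [simp]: "J a \<in> H"
  unfolding J_def using G.inv_closed[of "e * a * e"] by simp

lemma e_J [simp]: "e * J a = J a" and J_e [simp]: "J a * e = J a"
  using J_in_H[of a] by (simp_all add: H_iff)

lemma J_left: "J a * a * e = e"
proof -
  have "J a * (e * a * e) = e" unfolding J_def using G.l_inv[of "e * a * e"] by simp
  then show ?thesis by (simp add: mult.assoc[symmetric])
qed

lemma J_right: "e * a * J a = e"
proof -
  have "(e * a * e) * J a = e" unfolding J_def using G.r_inv[of "e * a * e"] by simp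
  then show ?thesis by (simp add: mult.assoc)
qed

lemma J_simps [simp]:
  "e * (J a * x) = J a * x" "J a * (e * x) = J a * x"
  "J a * (a * e) = e" "J a * (a * (e * x)) = e * x"
  "e * (a * J a) = e" "e * (a * (J a * x)) = e * x"
  "J a * (a * J b) = J b" "J a * (a * (J b * x)) = J b * x"
  "J b * (a * J a) = J b" "J b * (a * (J a * x)) = J b * x"
  by (metis e_J J_e J_left J_right mult.assoc)+

lemma J_e_mult [simp]: "J (e * a) = J a" and J_mult_e [simp]: "J (a * e) = J a"
  by (simp_all add: J_def mult.assoc)

lemma J_J: "J (J a) = e * a * e"
proof -
  have "J (J a) = inv\<^bsub>G\<^esub> (e * J a * e)" by (simp only: J_def)
  also have "\<dots> = inv\<^bsub>G\<^esub> (inv\<^bsub>G\<^esub> (e * a * e))" by (simp add: J_def[symmetric])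
  also have "\<dots> = e * a * e" by (rule G.inv_inv) simp
  finally show ?thesis .
qed

lemma J_mult: "J (a * (e * b)) = J b * J a"
proof -
  have "J (a * (e * b)) = inv\<^bsub>G\<^esub> ((e * a * e) \<otimes>\<^bsub>G\<^esub> (e * b * e))" by (simp add: J_def mult.assoc)
  also have "\<dots> = inv\<^bsub>G\<^esub> (e * b * e) \<otimes>\<^bsub>G\<^esub> inv\<^bsub>G\<^esub> (e * a * e)"
    by (rule G.inv_mult_group) simp_all
  finally show ?thesis by (simp add: J_def)
qed

lemma inv_G [simp]: "a \<in> H \<Longrightarrow> inv\<^bsub>G\<^esub> a = J a"
  by (simp add: J_def H_iff)

lemma J_regular:
  assumes "w \<in> K" shows "w * J w * w = w"
proof -
  obtain x y where w: "w = x * (e * y)"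
    using completely_simple_factorization[OF simple e_in_K assms] mult.assoc by metis
  have "w * J w * w = x * (e * y * J y) * (J x * x * e) * y"
    unfolding w J_mult by (simp add: mult.assoc)
  then show ?thesis unfolding J_left J_right w by (simp add: mult.assoc)
qed

lemma J_regular_simps:
  "w \<in> K \<Longrightarrow> w * (J w * w) = w" "w \<in> K \<Longrightarrow> w * (J w * (w * x)) = w * x"
  using J_regular by (metis mult.assoc)+

lemma row_coordinate_mult:
  assumes "k \<in> K" shows "k * s * J (k * s) = k * J k"
proof -
  have "k * s * J (k * s) = k * J k * (e * (k * s) * J (k * s))"
    using J_regular_simps(2)[OF assms] by (simp add: mult.assoc)
  then show ?thesis unfolding J_right by (simp add: mult.assoc)
qed

lemma column_coordinate_mult:
  assumes "k \<in> K" shows "J (s * k) * (s * k) = J k * k"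
proof -
  have "J (s * k) * (s * k) = (J (s * k) * (s * k) * e) * J k * k"
    using J_regular_simps(1)[OF assms] by (simp add: mult.assoc)
  then show ?thesis unfolding J_left by simp
qed

sublocale rows: invariant_coordinate "(*)" K "\<lambda>w. w * J w"
proof
  show "\<exists>s. k = l * s" if "k \<in> K" "k * J k = l * J l" for k l
    using J_regular[OF that(1)] unfolding that(2) by (metis mult.assoc)
qed (auto simp: ideal row_coordinate_mult)

sublocale columns: invariant_coordinate "\<lambda>a b. b * a" K "\<lambda>w. J w * w"
proof
  show "\<exists>s. k = s * l" if "k \<in> K" "J k * k = J l * l" for k l
    using J_regular_simps(1)[OF that(1)] unfolding that(2) by (metis mult.assoc)
qed (auto simp: ideal column_coordinate_mult)

lemma rees_coordinates_inject:
  assumes "a \<in> K" "b \<in> K"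
    and "a * J a = b * J b" "e * a * e = e * b * e" "J a * a = J b * b"
  shows "a = b"
proof -
  have "w = (w * J w) * (e * w * e) * (J w * w)" if "w \<in> K" for w
    using that by (simp add: mult.assoc J_regular_simps)
  then show ?thesis using assms by metis
qed

end

subsection \<open>Lower central series of groups\<close>

abbreviation group_commutator :: "('a, 'b) monoid_scheme \<Rightarrow> 'a \<Rightarrow> 'a \<Rightarrow> 'a" where
  "group_commutator G g h \<equiv> g \<otimes>\<^bsub>G\<^esub> h \<otimes>\<^bsub>G\<^esub> inv\<^bsub>G\<^esub> g \<otimes>\<^bsub>G\<^esub> inv\<^bsub>G\<^esub> h"

abbreviation commutator_subgroup :: "('a, 'b) monoid_scheme \<Rightarrow> 'a set \<Rightarrow> 'a set" where
  "commutator_subgroup G M \<equiv>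
     generate G (\<Union>g \<in> carrier G. \<Union>h \<in> M. {group_commutator G g h})"

context group
begin

lemma inv_group_commutator:
  "g \<in> carrier G \<Longrightarrow> h \<in> carrier G \<Longrightarrow> inv (group_commutator G g h) = group_commutator G h g"
  by (simp add: inv_mult_group m_assoc)

lemma commutator_subgroup_subset:
  assumes "M \<lhd> G" shows "commutator_subgroup G M \<subseteq> M"
proof -
  interpret M: normal M G by (rule assms)
  show ?thesis
    using M.inv_op_closed2 M.m_inv_closed M.m_closed
    by (intro generate_subgroup_incl M.subgroup_axioms) auto
qed

lemma commutator_subgroup_normal:
  assumes "M \<lhd> G" shows "commutator_subgroup G M \<lhd> G"
proof (rule normal_invI)
  interpret M: normal M G by (rule assms)
  show subgroup: "subgroup (commutator_subgroup G M) G"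
    by (intro generate_is_subgroup) auto
  fix g h assume g: "g \<in> carrier G" and h: "h \<in> commutator_subgroup G M"
  then have hM: "h \<in> M" using commutator_subgroup_subset[OF assms] by blast
  then have "group_commutator G g h \<in> commutator_subgroup G M"
    using g by (auto intro: generate.incl)
  then have "group_commutator G g h \<otimes> h \<in> commutator_subgroup G M"
    using h subgroup.m_closed[OF subgroup] by blast
  then show "g \<otimes> h \<otimes> inv g \<in> commutator_subgroup G M"
    using g hM by (simp add: m_assoc)
qed

lemma lower_central_normal: "lower_central G k \<lhd> G"
proof (induction k)
  case 0
  then show ?case by (simp add: normal_self)
next
  case (Suc k)
  then show ?case using commutator_subgroup_normal by simp
qed

lemma lower_central_subgroup: "subgroup (lower_central G k) G"
  using lower_central_normal by (rule normal_imp_subgroup)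

lemma lower_central_Suc_subset: "lower_central G (Suc k) \<subseteq> lower_central G k"
  using commutator_subgroup_subset[OF lower_central_normal] by simp

lemma group_commutator_lower_central:
  assumes "g \<in> carrier G" "h \<in> lower_central G k"
  shows "group_commutator G g h \<in> lower_central G (Suc k)"
    and "group_commutator G h g \<in> lower_central G (Suc k)"
proof -
  show "group_commutator G g h \<in> lower_central G (Suc k)"
    unfolding lower_central.simps using assms by (auto intro: generate.incl)
  then have "inv (group_commutator G g h) \<in> lower_central G (Suc k)"
    by (rule subgroup.m_inv_closed[OF lower_central_subgroup])
  moreover have "h \<in> carrier G"
    using assms(2) subgroup.subset[OF lower_central_subgroup] by blast
  ultimately show "group_commutator G h g \<in> lower_central G (Suc k)"
    using inv_group_commutator[OF assms(1)] by metis
qed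

lemma nilpotent_groupI:
  assumes "lower_central G k \<subseteq> {\<one>}" shows "nilpotent_group G"
  unfolding nilpotent_group_def
  using assms subgroup.one_closed[OF lower_central_subgroup, of k] by blast

lemma derived_series_normal: "(derived G ^^ k) (carrier G) \<lhd> G"
  by (induction k) (auto intro: normal_self derived_is_normal)

lemma rcos_conj_eq:
  assumes "L \<lhd> G" and [simp]: "u \<in> carrier G" "v \<in> carrier G" "x \<in> carrier G"
    and "group_commutator G (v \<otimes> inv u) (u \<otimes> x \<otimes> inv u) \<in> L"
  shows "L #> (v \<otimes> x \<otimes> inv v) = L #> (u \<otimes> x \<otimes> inv u)"
proof -
  interpret L: normal L G by (rule assms(1))
  define n m where "n = v \<otimes> inv u" and "m = u \<otimes> x \<otimes> inv u"
  have [simp]: "n \<in> carrier G" "m \<in> carrier G" by (simp_all add: n_def m_def)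
  have "v = n \<otimes> u" by (simp add: n_def m_assoc)
  then have "v \<otimes> x \<otimes> inv v = n \<otimes> m \<otimes> inv n" by (simp add: m_def inv_mult_group m_assoc)
  also have "\<dots> = group_commutator G n m \<otimes> m" by (simp add: m_assoc)
  finally have "v \<otimes> x \<otimes> inv v \<in> L #> m"
    using assms(5) by (simp add: n_def m_def rcosI L.subset)
  then show ?thesis
    using repr_independence[OF _ _ L.is_subgroup, of "v \<otimes> x \<otimes> inv v" m] by (simp add: m_def)
qed

end

subsection \<open>Congruences inside the \<open>\<H>\<close>-classes\<close>

context completely_simple_ideal
begin

text \<open>The quotient of the group coordinates \<open>(e b e) (e a e)\<^sup>-\<^sup>1\<close>.\<close>

definition group_quotient :: "'a \<Rightarrow> 'a \<Rightarrow> 'a" where "group_quotient a b = e * b * J a"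

lemma group_quotient_in_H [simp]: "group_quotient a b \<in> H"
  by (simp add: group_quotient_def H_iff mult.assoc)

lemma group_quotient_refl: "group_quotient a a = e"
  by (simp add: group_quotient_def mult.assoc)

lemma group_quotient_trans: "group_quotient a c = group_quotient b c * group_quotient a b"
  by (simp add: group_quotient_def mult.assoc)

lemma group_quotient_inverse: "group_quotient b a = J (group_quotient a b)"
proof -
  have "J (group_quotient a b) = J (e * b * (e * J a))" by (simp add: group_quotient_def mult.assoc)
  also have "\<dots> = J (J a) * J b" using J_mult[of "e * b" "J a"] by simp
  finally show ?thesis by (simp add: J_J group_quotient_def mult.assoc)
qed

lemma group_quotient_mult_right:
  assumes "J a * a = J b * b"
  shows "group_quotient (a * c) (b * c) = group_quotient a b"
proof -
  have "e * b = (e * b * e) * (J a * a)" unfolding assms by (simp add: mult.assoc)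
  then have "e * b = group_quotient a b * (e * a)" by (simp add: group_quotient_def mult.assoc)
  then have "group_quotient (a * c) (b * c) = group_quotient a b * (e * (a * c) * J (a * c))"
    by (simp add: group_quotient_def mult.assoc[symmetric])
  then show ?thesis unfolding J_right by (simp add: group_quotient_def mult.assoc)
qed

lemma group_quotient_mult_left:
  fixes b c d :: 'a
  assumes "c * J c = d * J d"
  defines "u \<equiv> e * b * c * J c"
  shows "group_quotient (b * c) (b * d) = u * group_quotient c d * J u"
proof -
  have "e * b * d * e = e * b * (d * J d) * (e * d * e)" by (simp add: mult.assoc)
  then have bd: "e * b * d * e = u * (e * d * e)"
    unfolding assms(1)[symmetric] by (simp add: u_def mult.assoc)
  have "u * (e * c) * e = e * (b * c) * e" by (simp add: u_def mult.assoc)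
  then have "J (u * (e * c)) = J (b * c)" using J_e_mult J_mult_e by metis
  then have "J (b * c) = J c * J u" by (simp add: J_mult)
  moreover have "group_quotient (b * c) (b * d) = (e * b * d * e) * J (b * c)"
    by (simp add: group_quotient_def mult.assoc)
  ultimately show ?thesis unfolding bd by (simp add: group_quotient_def mult.assoc)
qed

lemma group_quotient_mult:
  assumes "J a * a = J b * b" "c * J c = d * J d"
  defines "u \<equiv> e * b * c * J c"
  shows "group_quotient (a * c) (b * d) = u * group_quotient c d * J u * group_quotient a b"
  unfolding u_def
  using group_quotient_trans[of "a * c" "b * d" "b * c"]
    group_quotient_mult_right[OF assms(1)] group_quotient_mult_left[OF assms(2)] by simp

definition normal_congruence :: "'a set \<Rightarrow> 'a rel" where
  "normal_congruence L =
    {(a, b) \<in> rows.same_coordinate \<inter> columns.same_coordinate. group_quotient a b \<in> L}"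

lemma normal_congruence_iff:
  "(a, b) \<in> normal_congruence L \<longleftrightarrow>
    (a, b) \<in> rees K \<and> a * J a = b * J b \<and> J a * a = J b * b \<and> group_quotient a b \<in> L"
  unfolding normal_congruence_def rows.same_coordinate_def columns.same_coordinate_def by auto

lemma sg_congruence_normal_congruence:
  assumes "L \<lhd> G" shows "sg_congruence (normal_congruence L)"
proof -
  interpret L: normal L G by (rule assms)
  note rows = rows.sg_congruence_same_coordinate and columns = columns.sg_congruence_same_coordinate
  show ?thesis
  proof (rule sg_congruenceI)
    fix a b s
    show "(a, a) \<in> normal_congruence L"
      using L.one_closed by (simp add: normal_congruence_iff rees_def group_quotient_refl)
    assume ab: "(a, b) \<in> normal_congruence L"
    then have L: "group_quotient a b \<in> L" by (simp add: normal_congruence_iff)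
    then show "(b, a) \<in> normal_congruence L"
      using ab L.m_inv_closed[of "group_quotient a b"]
      by (auto simp: normal_congruence_iff rees_def group_quotient_inverse[of b a])
    have "e * s * a * J a \<in> H" by (simp add: H_iff mult.assoc)
    then have "group_quotient (s * a) (s * b) \<in> L"
      using group_quotient_mult_left[of a b s] ab L.inv_op_closed2[OF _ L]
      by (simp add: normal_congruence_iff)
    then show "(s * a, s * b) \<in> normal_congruence L"
      using ab sg_congruence_mult_left[OF rows] sg_congruence_mult_left[OF columns]
      by (simp add: normal_congruence_def)
    have "group_quotient (a * s) (b * s) \<in> L"
      using group_quotient_mult_right ab L by (simp add: normal_congruence_iff)
    then show "(a * s, b * s) \<in> normal_congruence L"
      using ab sg_congruence_mult_right[OF rows] sg_congruence_mult_right[OF columns]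
      by (simp add: normal_congruence_def)
  next
    fix a b c assume "(a, b) \<in> normal_congruence L" "(b, c) \<in> normal_congruence L"
    then show "(a, c) \<in> normal_congruence L"
      using L.m_closed[of "group_quotient b c" "group_quotient a b"]
      by (auto simp: normal_congruence_iff rees_def group_quotient_trans[of a c b])
  qed
qed

lemma normal_congruence_trivial: "normal_congruence {e} \<subseteq> Id"
proof (rule subrelI)
  fix a b assume ab: "(a, b) \<in> normal_congruence {e}"
  have "e * b * e = group_quotient a b * (e * a * e)" by (simp add: group_quotient_def mult.assoc)
  then have "e * a * e = e * b * e"
    using ab by (simp add: normal_congruence_iff mult.assoc)
  then show "(a, b) \<in> Id"
    using ab rees_coordinates_inject[of a b] by (auto simp: normal_congruence_iff rees_def)
qed

context
  fixes L M N :: "'a set" and \<alpha> :: "'a rel"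
  assumes L: "L \<lhd> G" and M: "M \<lhd> G" and N: "N \<subseteq> H" and \<alpha>: "sg_congruence \<alpha>"
    and commutators: "\<And>n m. n \<in> N \<Longrightarrow> m \<in> M \<Longrightarrow> group_commutator G n m \<in> L"
    and quotients: "\<And>a a' c c'. (a, a') \<in> \<alpha> \<Longrightarrow> (c, c') \<in> \<alpha> \<Longrightarrow>
      group_quotient (a * c * J c) (a' * c' * J c') \<in> N"
begin

lemma rcos_group_quotient_matrix:
  assumes "commutator_matrix \<alpha> (normal_congruence M) a b c d"
  shows "L #>\<^bsub>G\<^esub> group_quotient a b = L #>\<^bsub>G\<^esub> group_quotient c d"
  using assms
proof induction
  case (mult a b c d a' b' c' d')
  interpret L: normal L G by (rule L)
  interpret M: normal M G by (rule M)
  define u v where "u = e * b * a' * J a'" and "v = e * d * c' * J c'"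
  define x y where "x = group_quotient a' b'" and "y = group_quotient c' d'"
  note rows = commutator_matrix_rows[OF _ sg_congruence_normal_congruence[OF M]]
  have xM: "x \<in> M"
    using rows(1)[OF mult.hyps(2)] by (simp add: x_def normal_congruence_iff)
  have [simp]: "u \<in> H" "v \<in> H" by (simp_all add: u_def v_def H_iff mult.assoc)
  have [simp]: "x \<in> H" "y \<in> H" by (simp_all add: x_def y_def)
  have product: "L #>\<^bsub>G\<^esub> (s * t) = (L #>\<^bsub>G\<^esub> s) <#>\<^bsub>G\<^esub> (L #>\<^bsub>G\<^esub> t)" if "s \<in> H" "t \<in> H" for s t
    using L.rcos_sum[of s t] that by simp

  have "v * J u = group_quotient (b * a' * J a') (d * c' * J c')"
    using J_e_mult[of "b * a' * J a'"] by (simp add: group_quotient_def u_def v_def mult.assoc)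
  then have vu: "v * J u \<in> N"
    using quotients commutator_matrix_columns[OF mult.hyps(1) \<alpha>]
      commutator_matrix_columns[OF mult.hyps(2) \<alpha>] by simp
  moreover have "u * x * J u \<in> M" using M.inv_op_closed2[of u x] xM by simp
  ultimately have "group_commutator G (v * J u) (u * x * J u) \<in> L" by (rule commutators)
  then have "L #>\<^bsub>G\<^esub> (u * x * J u) = L #>\<^bsub>G\<^esub> (v * x * J v)"
    using G.rcos_conj_eq[OF L, of u v x] by simp
  also have "\<dots> = L #>\<^bsub>G\<^esub> (v * y * J v)"
    using mult.IH(2) by (simp add: product x_def y_def)
  finally have "L #>\<^bsub>G\<^esub> (u * x * J u * group_quotient a b) =
      L #>\<^bsub>G\<^esub> (v * y * J v * group_quotient c d)"
    using mult.IH(1) by (simp add: product)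
  then show ?case
    using rows[OF mult.hyps(1)] rows[OF mult.hyps(2)]
      group_quotient_mult[of a b a' b'] group_quotient_mult[of c d c' d']
    by (simp add: normal_congruence_iff u_def v_def x_def y_def)
qed (simp_all add: group_quotient_refl)

lemma TC_holds_normal_congruence_right: "TC_holds [\<alpha>, normal_congruence M] (normal_congruence L)"
  unfolding TC_holds_binary_iff
proof (intro allI impI)
  fix a b c d
  assume matrix: "commutator_matrix \<alpha> (normal_congruence M) a b c d"
    and ab: "(a, b) \<in> normal_congruence L"
  interpret L: normal L G by (rule L)
  have "L #>\<^bsub>G\<^esub> group_quotient c d = L"
    using rcos_group_quotient_matrix[OF matrix] G.coset_join2[OF _ L.is_subgroup] ab
    by (simp add: normal_congruence_iff)
  then have "group_quotient c d \<in> L"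
    using G.coset_join1[OF _ _ L.is_subgroup] by simp
  then show "(c, d) \<in> normal_congruence L"
    using commutator_matrix_rows(2)[OF matrix sg_congruence_normal_congruence[OF M]]
    by (simp add: normal_congruence_iff)
qed

lemma TC_holds_normal_congruence_left: "TC_holds [normal_congruence M, \<alpha>] (normal_congruence L)"
  unfolding TC_holds_binary_iff
proof (intro allI impI)
  fix a b c d
  assume matrix: "commutator_matrix (normal_congruence M) \<alpha> a b c d"
    and ab: "(a, b) \<in> normal_congruence L"
  interpret L: normal L G by (rule L)
  define x y where "x = group_quotient a c" and "y = group_quotient b d"
  have H [simp]: "x \<in> H" "y \<in> H" by (simp_all add: x_def y_def)
  have "L #>\<^bsub>G\<^esub> x = L #>\<^bsub>G\<^esub> y"
    unfolding x_def y_def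
    using commutator_matrix_transpose[OF matrix] by (rule rcos_group_quotient_matrix)
  then obtain l where l: "l \<in> L" "x = l * y"
    using G.rcos_self[OF _ L.is_subgroup, of x] unfolding r_coset_def by auto
  have "group_quotient c d = y * group_quotient a b * J x"
    using group_quotient_trans[of c d a] group_quotient_trans[of a d b]
    unfolding x_def y_def group_quotient_inverse[of c a] by simp
  also have "J x = J y * J l"
    using J_mult[of l y] H(2) by (simp add: l(2) H_iff)
  finally have "group_quotient c d = (y * group_quotient a b * J y) * J l"
    by (simp add: mult.assoc)
  moreover have "y * group_quotient a b * J y \<in> L"
    using L.inv_op_closed2[of y "group_quotient a b"] ab by (simp add: normal_congruence_iff)
  moreover have "J l \<in> L" using L.m_inv_closed[OF l(1)] L.mem_carrier[OF l(1)] by simp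
  ultimately have "group_quotient c d \<in> L"
    using L.m_closed[of _ "J l"] by simp
  moreover have "(a, c) \<in> normal_congruence M" "(b, d) \<in> normal_congruence M"
    by (rule commutator_matrix_columns[OF matrix sg_congruence_normal_congruence[OF M]])+
  ultimately show "(c, d) \<in> normal_congruence L"
    using ab unfolding normal_congruence_iff rees_def by auto
qed

end

subsection \<open>Solvable and nilpotent extensions\<close>

lemma nilpotent_modulo_H_classes:
  assumes "nilpotent_extension K" shows "nilpotent_modulo (normal_congruence H)"
proof -
  have "normal_congruence H = rows.same_coordinate \<inter> columns.same_coordinate"
    by (auto simp: normal_congruence_def)
  then show ?thesis
    using nilpotent_modulo_Int rows.nilpotent_modulo_same_coordinate[OF assms]
      columns.nilpotent_modulo_same_coordinate[OF assms] by simp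
qed

lemma TC_holds_derived:
  assumes D: "D \<lhd> G" and D': "derived G D \<lhd> G"
  shows "TC_holds [normal_congruence D, normal_congruence D] (normal_congruence (derived G D))"
proof (rule TC_holds_normal_congruence_right[OF D' D _ sg_congruence_normal_congruence[OF D]])
  show "D \<subseteq> H" using subgroup.subset[OF normal_imp_subgroup[OF D]] by simp
  show "group_commutator G n m \<in> derived G D" if "n \<in> D" "m \<in> D" for n m
    unfolding derived_def using that by (intro generate.incl) blast
  fix a a' c c'
  assume "(a, a') \<in> normal_congruence D" and c: "(c, c') \<in> normal_congruence D"
  then have "(a * (c * J c), a' * (c * J c)) \<in> normal_congruence D"
    using sg_congruence_mult_right[OF sg_congruence_normal_congruence[OF D]] by blast
  moreover have "c * J c = c' * J c'" using c by (simp add: normal_congruence_iff)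
  ultimately show "group_quotient (a * c * J c) (a' * c' * J c') \<in> D"
    by (simp add: normal_congruence_iff mult.assoc)
qed

lemma sg_solvable_if_solvable:
  assumes "nilpotent_extension K" "solvable G" shows "sg_solvable TYPE('a)"
proof -
  let ?D = "\<lambda>k. (derived G ^^ k) H"
  have normal: "?D k \<lhd> G" for k using G.derived_series_normal[of k] by simp
  have "\<exists>d. derived_pow d \<subseteq> normal_congruence (?D k)" for k
  proof (induction k)
    case 0
    then show ?case
      using nilpotent_modulo_derived_pow[OF nilpotent_modulo_H_classes[OF assms(1)]] by simp
  next
    case (Suc k)
    then obtain d where d: "derived_pow d \<subseteq> normal_congruence (?D k)" by blast
    have "TC_holds [normal_congruence (?D k), normal_congruence (?D k)]
        (normal_congruence (?D (Suc k)))"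
      using TC_holds_derived[OF normal[of k]] normal[of "Suc k"] by simp
    then have "TC_holds [derived_pow d, derived_pow d] (normal_congruence (?D (Suc k)))"
      using d d by (rule TC_holds_antimono)
    then have "derived_pow (Suc d) \<subseteq> normal_congruence (?D (Suc k))"
      unfolding derived_pow.simps
      by (intro commutator_subset sg_congruence_normal_congruence normal)
    then show ?case ..
  qed
  moreover obtain k where "?D k = {e}"
    using assms(2) G.solvable_iff_trivial_derived_seq by auto
  ultimately obtain d where "derived_pow d \<subseteq> (Id :: 'a rel)"
    using normal_congruence_trivial subset_trans by metis
  then show ?thesis
    unfolding sg_solvable_def using sg_congruence_eq_IdI[OF sg_congruence_derived_pow] by blast
qed

lemma central_step_lower_central:
  "central_step (normal_congruence (lower_central G k))
    (normal_congruence (lower_central G (Suc k)))"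
proof -
  note normal = G.lower_central_normal
  have commutators: "group_commutator G n m \<in> lower_central G (Suc k)"
    if "n \<in> H" "m \<in> lower_central G k" for n m
    using G.group_commutator_lower_central(1)[OF _ that(2), of n] that(1) by simp
  show ?thesis
    unfolding central_step_def
    using normal[of "Suc k"] normal[of k] subset_refl[of H] sg_congruence_UNIV commutators
    by (intro conjI sg_congruence_normal_congruence TC_holds_normal_congruence_right
        TC_holds_normal_congruence_left) auto
qed

lemma nilpotent_modulo_Id:
  assumes "nilpotent_extension K" "nilpotent_group G" shows "nilpotent_modulo (Id :: 'a rel)"
proof -
  have "nilpotent_modulo (normal_congruence (lower_central G k))" for k
  proof (induction k)
    case 0
    then show ?case using nilpotent_modulo_H_classes[OF assms(1)] by simp
  next
    case (Suc k)
    then show ?case using central_step_lower_central by (rule nilpotent_modulo_step)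
  qed
  moreover obtain k where "lower_central G k = {e}"
    using assms(2) unfolding nilpotent_group_def by auto
  ultimately show ?thesis using normal_congruence_trivial nilpotent_modulo_mono by metis
qed

end

subsection \<open>Higher commutators and functions on subsets\<close>

text \<open>\<open>cube_words n\<close> is \<open>M(1, \<dots>, 1)\<close> with \<open>n\<close> entries, where the vertices of the cube are the
  subsets of \<open>{..<n}\<close>.\<close>

inductive_set cube_words :: "nat \<Rightarrow> (nat set \<Rightarrow> 'a::semigroup_mult) set" for n where
  gen: "i < n \<Longrightarrow> (\<lambda>X. if i \<in> X then b else a) \<in> cube_words n"
| mult: "F \<in> cube_words n \<Longrightarrow> F' \<in> cube_words n \<Longrightarrow> (\<lambda>X. F X * F' X) \<in> cube_words n"

lemma cube_words_if_Mgen: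
  assumes "f \<in> Mgen (replicate n UNIV)"
  shows "(\<lambda>X. f (map (\<lambda>i. i \<in> X) [0..<n])) \<in> cube_words n"
  using assms
proof (induction rule: Mgen.induct)
  case (gen i a b)
  then have "(\<lambda>X. if map (\<lambda>i. i \<in> X) [0..<n] ! i then b else a) = (\<lambda>X. if i \<in> X then b else a)"
    by simp
  then show ?case using gen by (simp add: cube_words.gen)
qed (rule cube_words.mult)

lemma Mgen_if_cube_words:
  assumes "F \<in> cube_words n"
  shows "(\<lambda>x. F {i. i < n \<and> x ! i}) \<in> Mgen (replicate n UNIV)"
  using assms
proof (induction rule: cube_words.induct)
  case (gen i b a)
  then show ?case using Mgen.gen[of i "replicate n UNIV" a b] by simp
qed (rule Mgen.mult)

lemma cube_words_Int: "F \<in> cube_words n \<Longrightarrow> F (X \<inter> {..<n}) = F X"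
  by (induction rule: cube_words.induct) auto

lemma cube_words_mono: "F \<in> cube_words n \<Longrightarrow> n \<le> n' \<Longrightarrow> F \<in> cube_words n'"
  by (induction rule: cube_words.induct) (auto intro: cube_words.intros)

definition term_condition :: "'i \<Rightarrow> 'i set \<Rightarrow> ('i set \<Rightarrow> 'b) \<Rightarrow> bool" where
  "term_condition v W F \<longleftrightarrow> (\<forall>X. X \<subset> W \<longrightarrow> F X = F (insert v X)) \<longrightarrow> F W = F (insert v W)"

lemma term_condition_if_TC_holds:
  fixes F :: "nat set \<Rightarrow> 'a::semigroup_mult"
  assumes TC: "TC_holds (replicate (Suc d) UNIV) (Id :: 'a rel)" and F: "F \<in> cube_words (Suc d)"
  shows "term_condition d {..<d} F"
  unfolding term_condition_def
proof
  assume eq: "\<forall>X. X \<subset> {..<d} \<longrightarrow> F X = F (insert d X)"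
  define set_of where "set_of x = {i. i < Suc d \<and> x ! i}" for x :: "bool list"
  have set_of: "set_of (x @ [False]) = {i. i < d \<and> x ! i}"
    "set_of (x @ [True]) = insert d {i. i < d \<and> x ! i}" if "length x = d" for x
    using that by (auto simp: set_of_def nth_append less_Suc_eq)
  have "F (set_of (x @ [False])) = F (set_of (x @ [True]))"
    if x: "length x = d" "x \<noteq> replicate d True" for x
  proof -
    obtain i where "i < d" "\<not> x ! i" using x by (auto simp: list_eq_iff_nth_eq)
    then have "{i. i < d \<and> x ! i} \<subset> {..<d}" by auto
    then show ?thesis using eq set_of x by simp
  qed
  then have "F (set_of (replicate d True @ [False])) = F (set_of (replicate d True @ [True]))"
    using TC[unfolded TC_holds_def, rule_format, OF Mgen_if_cube_words[OF F]]
    by (simp add: set_of_def)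
  moreover have "{i. i < d \<and> replicate d True ! i} = {..<d}" by auto
  ultimately show "F {..<d} = F (insert d {..<d})" by (simp add: set_of)
qed

lemma TC_holds_if_term_condition:
  assumes TC: "\<And>F :: nat set \<Rightarrow> 'a::semigroup_mult.
    F \<in> cube_words (Suc d) \<Longrightarrow> term_condition d {..<d} F"
  shows "TC_holds (replicate (Suc d) UNIV) (Id :: 'a rel)"
  unfolding TC_holds_def
proof (intro ballI impI)
  let ?R = "replicate (Suc d) (UNIV :: 'a rel)"
  fix f :: "bool list \<Rightarrow> 'a"
  assume f: "f \<in> Mgen ?R" and eq: "\<forall>x. length x = length ?R - 1 \<and>
    x \<noteq> replicate (length ?R - 1) True \<longrightarrow> (f (x @ [False]), f (x @ [True])) \<in> Id"
  define list_of where "list_of n X = map (\<lambda>i. i \<in> X) [0..<n]" for n and X :: "nat set"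
  have list_of: "list_of (Suc d) X = list_of d X @ [False]"
    "list_of (Suc d) (insert d X) = list_of d X @ [True]" if "X \<subseteq> {..<d}" for X
    using that by (auto simp: list_of_def)
  have "f (list_of (Suc d) X) = f (list_of (Suc d) (insert d X))" if X: "X \<subset> {..<d}" for X
  proof -
    obtain i where "i < d" "i \<notin> X" using X by auto
    then have "list_of d X ! i \<noteq> replicate d True ! i" by (simp add: list_of_def)
    then have "list_of d X \<noteq> replicate d True" by metis
    moreover have "length (list_of d X) = d" by (simp add: list_of_def)
    ultimately show ?thesis using eq list_of X by auto
  qed
  moreover have "term_condition d {..<d} (\<lambda>X. f (list_of (Suc d) X))"
    unfolding list_of_def by (rule TC[OF cube_words_if_Mgen[OF f]])
  ultimately have "f (list_of (Suc d) {..<d}) = f (list_of (Suc d) (insert d {..<d}))"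
    unfolding term_condition_def by simp
  moreover have "list_of d {..<d} = replicate d True"
    by (auto simp: list_of_def list_eq_iff_nth_eq)
  ultimately show "(f (replicate (length ?R - 1) True @ [False]),
    f (replicate (length ?R - 1) True @ [True])) \<in> Id" using list_of by simp
qed

lemma commutator_replicate_eq_Id_iff:
  "commutator (replicate (Suc d) UNIV) = (Id :: 'a::semigroup_mult rel) \<longleftrightarrow>
    (\<forall>F \<in> cube_words (Suc d). term_condition d {..<d} (F :: nat set \<Rightarrow> 'a))"
  unfolding commutator_eq_Id_iff
  using term_condition_if_TC_holds TC_holds_if_term_condition by blast

subsection \<open>Juntas\<close>

definition junta :: "'i set \<Rightarrow> nat \<Rightarrow> ('i set \<Rightarrow> 'b) \<Rightarrow> bool" where
  "junta V r F \<longleftrightarrow> (\<exists>A \<subseteq> V. finite A \<and> card A \<le> r \<and> (\<forall>X. F X = F (X \<inter> A)))"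

lemma junta_compose: "junta V r F \<Longrightarrow> junta V r (\<lambda>X. h (F X))"
  unfolding junta_def by metis

lemma junta_mono: "junta V r F \<Longrightarrow> r \<le> s \<Longrightarrow> junta V s F"
  unfolding junta_def using le_trans by blast

lemma junta_compose2:
  assumes "junta V r F" "junta V s F'" shows "junta V (r + s) (\<lambda>X. h (F X) (F' X))"
proof -
  obtain A where A: "A \<subseteq> V" "finite A" "card A \<le> r" "\<And>X. F X = F (X \<inter> A)"
    using assms(1) unfolding junta_def by blast
  obtain B where B: "B \<subseteq> V" "finite B" "card B \<le> s" "\<And>X. F' X = F' (X \<inter> B)"
    using assms(2) unfolding junta_def by blast
  have "X \<inter> (A \<union> B) \<inter> A = X \<inter> A" "X \<inter> (A \<union> B) \<inter> B = X \<inter> B" for X by auto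
  then have "h (F X) (F' X) = h (F (X \<inter> (A \<union> B))) (F' (X \<inter> (A \<union> B)))" for X
    using A(4) B(4) by metis
  moreover have "card (A \<union> B) \<le> r + s" using card_Un_le[of A B] A(3) B(3) by linarith
  ultimately show ?thesis
    unfolding junta_def using A(1,2) B(1,2) by (intro exI[of _ "A \<union> B"]) auto
qed

lemma junta_indicator: "i \<in> V \<Longrightarrow> junta V 1 (\<lambda>X. if i \<in> X then b else a)"
  unfolding junta_def by (intro exI[of _ "{i}"]) auto

lemma junta_term_condition:
  assumes "junta V r F" "r < card W" "v \<notin> W" shows "term_condition v W F"
  unfolding term_condition_def
proof
  assume eq: "\<forall>X. X \<subset> W \<longrightarrow> F X = F (insert v X)"
  obtain A where A: "finite A" "card A \<le> r" "\<And>X. F X = F (X \<inter> A)"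
    using assms(1) unfolding junta_def by blast
  then have "\<not> W \<subseteq> A" using card_mono[of A W] assms(2) by linarith
  then obtain i where i: "i \<in> W" "i \<notin> A" by blast
  then have "F (W - {i}) = F (insert v (W - {i}))" using eq by blast
  moreover have "(W - {i}) \<inter> A = W \<inter> A" "insert v (W - {i}) \<inter> A = insert v W \<inter> A"
    using i assms(3) by auto
  ultimately show "F W = F (insert v W)" using A(3) by metis
qed

context orientation
begin

lemma cube_words_op_induct [consumes 1, case_names gen op]:
  assumes "F \<in> cube_words n"
    and "\<And>i a b. i < n \<Longrightarrow> Q (\<lambda>X. if i \<in> X then b else a)"
    and "\<And>F F'. \<lbrakk>F \<in> cube_words n; F' \<in> cube_words n; Q F; Q F'\<rbrakk> \<Longrightarrow> Q (\<lambda>X. F X \<cdot> F' X)"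
  shows "Q F"
  using assms(1)
proof induction
  case (mult F F')
  from orientation show ?case
  proof
    assume "(\<cdot>) = (*)"
    then show ?thesis using assms(3)[OF mult] by simp
  next
    assume "(\<cdot>) = (\<lambda>a b. b * a)"
    then show ?thesis using assms(3)[OF mult(2,1,4,3)] by simp
  qed
qed (fact assms(2))

text \<open>Either the word \<open>F\<close> has at most \<open>k\<close> letters, or its first \<open>k\<close> letters can be split off.\<close>

definition prefix_junta :: "nat \<Rightarrow> nat \<Rightarrow> (nat set \<Rightarrow> 'a) \<Rightarrow> bool" where
  "prefix_junta n k F \<longleftrightarrow> (\<exists>j \<le> k. junta {..<n} j F \<and> range F \<subseteq> sg_power j) \<or>
    (\<exists>U W. junta {..<n} k U \<and> range U \<subseteq> sg_power k \<and> F = (\<lambda>X. U X \<cdot> W X))"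

lemma prefix_junta_append:
  assumes F: "junta {..<n} j F" "range F \<subseteq> sg_power j" and F': "prefix_junta n k F'"
  shows "prefix_junta n (j + k) (\<lambda>X. F X \<cdot> F' X)"
proof -
  have append: "junta {..<n} (j + l) (\<lambda>X. F X \<cdot> P X)"
    "range (\<lambda>X. F X \<cdot> P X) \<subseteq> sg_power (j + l)"
    if "junta {..<n} l P" "range P \<subseteq> sg_power l" for P l
    using junta_compose2[OF F(1) that(1)] F(2) that(2) sg_power_op by blast+
  from F' consider
    (short) l where "l \<le> k" "junta {..<n} l F'" "range F' \<subseteq> sg_power l" |
    (long) U W where "junta {..<n} k U" "range U \<subseteq> sg_power k" "F' = (\<lambda>X. U X \<cdot> W X)"
    unfolding prefix_junta_def by blast
  then show ?thesis
  proof cases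
    case short
    then show ?thesis
      unfolding prefix_junta_def using append[OF short(2,3)]
      by (intro disjI1 exI[of _ "j + l"]) simp
  next
    case long
    then have "(\<lambda>X. F X \<cdot> F' X) = (\<lambda>X. F X \<cdot> U X \<cdot> W X)" by (simp add: op_assoc)
    then show ?thesis unfolding prefix_junta_def using append[OF long(1,2)] by blast
  qed
qed

lemma prefix_junta_cube_words: "F \<in> cube_words n \<Longrightarrow> 1 \<le> k \<Longrightarrow> prefix_junta n k F"
proof (induction arbitrary: k rule: cube_words_op_induct)
  case (gen i a b)
  then show ?case
    unfolding prefix_junta_def using junta_indicator[of i "{..<n}" b a]
    by (intro disjI1 exI[of _ 1]) simp
next
  case (op F F')
  from op.IH(1)[OF op.prems] consider
    (short) j where "j < k" "junta {..<n} j F" "range F \<subseteq> sg_power j" |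
    (full) "junta {..<n} k F" "range F \<subseteq> sg_power k" |
    (long) U W where "junta {..<n} k U" "range U \<subseteq> sg_power k" "F = (\<lambda>X. U X \<cdot> W X)"
    unfolding prefix_junta_def by (metis order_le_less)
  then show ?case
  proof cases
    case short
    then have "prefix_junta n (k - j) F'" by (intro op.IH(2)) simp
    then have "prefix_junta n (j + (k - j)) (\<lambda>X. F X \<cdot> F' X)"
      by (rule prefix_junta_append[OF short(2,3)])
    then show ?thesis using short(1) by simp
  next
    case full
    then show ?thesis unfolding prefix_junta_def by blast
  next
    case long
    then have "(\<lambda>X. F X \<cdot> F' X) = (\<lambda>X. U X \<cdot> (W X \<cdot> F' X))" by (simp add: op_assoc)
    then show ?thesis
      unfolding prefix_junta_def using long(1,2)
      by (intro disjI2 exI[of _ U] exI[of _ "\<lambda>X. W X \<cdot> F' X"]) simp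
  qed
qed

end

context invariant_coordinate
begin

lemma junta_or_range_subset:
  assumes "1 \<le> m" "sg_power m \<subseteq> K" "F \<in> cube_words n"
  shows "junta {..<n} m F \<or> range F \<subseteq> K"
  using prefix_junta_cube_words[OF assms(3,1)] unfolding prefix_junta_def
proof
  assume "\<exists>j \<le> m. junta {..<n} j F \<and> range F \<subseteq> sg_power j"
  then show ?thesis using junta_mono by blast
next
  assume "\<exists>U W. junta {..<n} m U \<and> range U \<subseteq> sg_power m \<and> F = (\<lambda>X. U X \<cdot> W X)"
  then show ?thesis using assms(2) sg_ideal_op(2)[OF ideal] by blast
qed

lemma junta_coordinate:
  assumes "1 \<le> m" "sg_power m \<subseteq> K" "F \<in> cube_words n"
  shows "junta {..<n} m (\<lambda>X. \<pi> (F X))"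
  using prefix_junta_cube_words[OF assms(3,1)] unfolding prefix_junta_def
proof
  assume "\<exists>j \<le> m. junta {..<n} j F \<and> range F \<subseteq> sg_power j"
  then obtain j where "j \<le> m" "junta {..<n} j F" by blast
  then show ?thesis using junta_mono[OF junta_compose] by blast
next
  assume "\<exists>U W. junta {..<n} m U \<and> range U \<subseteq> sg_power m \<and> F = (\<lambda>X. U X \<cdot> W X)"
  then obtain U W where U: "junta {..<n} m U" "range U \<subseteq> sg_power m" "F = (\<lambda>X. U X \<cdot> W X)"
    by blast
  then have "\<pi> (F X) = \<pi> (U X)" for X using assms(2) invariant by blast
  then show ?thesis using junta_compose[OF U(1), of \<pi>] by simp
qed

end

subsection \<open>Cube groups\<close>

definition face :: "('a, 'b) monoid_scheme \<Rightarrow> 'i set \<Rightarrow> 'a \<Rightarrow> 'i set \<Rightarrow> 'a" where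
  "face G A g X = (if A \<subseteq> X then g else \<one>\<^bsub>G\<^esub>)"

inductive_set cube_group ::
  "('a, 'b) monoid_scheme \<Rightarrow> 'i set \<Rightarrow> ('i set \<Rightarrow> 'a set) \<Rightarrow> ('i set \<Rightarrow> 'a) set"
  for G (structure) and V N where
  face: "A \<subseteq> V \<Longrightarrow> g \<in> N A \<Longrightarrow> face G A g \<in> cube_group G V N"
| mult: "F \<in> cube_group G V N \<Longrightarrow> F' \<in> cube_group G V N \<Longrightarrow>
    (\<lambda>X. F X \<otimes> F' X) \<in> cube_group G V N"

lemma face_insert: "face G A g (insert v X) = face G (A - {v}) g X"
  by (simp add: face_def subset_insert_iff)

lemma face_Diff: "face G A g (X - {v}) = (if v \<in> A then \<one>\<^bsub>G\<^esub> else face G A g X)"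
  by (auto simp: face_def)

context group
begin

lemma face_closed: "g \<in> carrier G \<Longrightarrow> face G A g X \<in> carrier G"
  by (simp add: face_def)

lemma face_conj:
  assumes "g \<in> carrier G" "h \<in> carrier G"
  shows "face G A g X \<otimes> face G B h X \<otimes> inv (face G A g X) =
    face G (A \<union> B) (group_commutator G g h) X \<otimes> face G B h X"
  using assms by (simp add: face_def m_assoc)

definition face_filtration :: "('i set \<Rightarrow> 'a set) \<Rightarrow> bool" where
  "face_filtration N \<longleftrightarrow> (\<forall>A. subgroup (N A) G) \<and>
     (\<forall>A B. \<forall>g \<in> N A. \<forall>h \<in> N B. group_commutator G g h \<in> N (A \<union> B))"

lemma face_filtration_subgroup: "face_filtration N \<Longrightarrow> subgroup (N A) G"
  by (simp add: face_filtration_def)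

lemma face_filtration_commutator:
  "face_filtration N \<Longrightarrow> g \<in> N A \<Longrightarrow> h \<in> N B \<Longrightarrow> group_commutator G g h \<in> N (A \<union> B)"
  by (simp add: face_filtration_def)

lemma face_filtration_carrier: "face_filtration N \<Longrightarrow> g \<in> N A \<Longrightarrow> g \<in> carrier G"
  using face_filtration_subgroup subgroup.mem_carrier by metis

lemma face_filtration_insert:
  assumes "face_filtration N" shows "face_filtration (\<lambda>A. N (insert v A))"
proof -
  have "group_commutator G g h \<in> N (insert v (A \<union> B))"
    if "g \<in> N (insert v A)" "h \<in> N (insert v B)" for g h A B
    using face_filtration_commutator[OF assms that] by simp
  then show ?thesis
    using face_filtration_subgroup[OF assms] by (simp add: face_filtration_def)
qed

lemma cube_group_closed: "F \<in> cube_group G V N \<Longrightarrow> face_filtration N \<Longrightarrow> F X \<in> carrier G"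
  by (induction rule: cube_group.induct) (auto simp: face_closed dest: face_filtration_carrier)

lemma one_in_cube_group:
  fixes V :: "'i set"
  assumes "face_filtration N" shows "(\<lambda>X. \<one>) \<in> cube_group G V N"
proof -
  have "\<one> \<in> N {}" using face_filtration_subgroup[OF assms] by (rule subgroup.one_closed)
  then have "face G {} \<one> \<in> cube_group G V N" by (intro cube_group.face) auto
  moreover have "face G {} \<one> = (\<lambda>X :: 'i set. \<one>)" by (simp add: face_def fun_eq_iff)
  ultimately show ?thesis by simp
qed

lemma conj_face_cube_group:
  assumes N: "face_filtration N" and A: "A \<subseteq> V" "g \<in> N A"
    and F: "F \<in> cube_group G V (\<lambda>A. N (insert v A))"
  shows "(\<lambda>X. face G A g X \<otimes> F X \<otimes> inv (face G A g X)) \<in> cube_group G V (\<lambda>A. N (insert v A))"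
  using F
proof (induction rule: cube_group.induct)
  case (face B h)
  have carrier: "g \<in> carrier G" "h \<in> carrier G"
    using A face face_filtration_carrier[OF N] by blast+
  have "group_commutator G g h \<in> N (insert v (A \<union> B))"
    using face_filtration_commutator[OF N A(2) face(2)] by simp
  then show ?case
    unfolding face_conj[OF carrier] using A face by (intro cube_group.intros) auto
next
  case (mult F F')
  let ?g = "\<lambda>X. face G A g X"
  have "?g X \<in> carrier G" "F X \<in> carrier G" "F' X \<in> carrier G" for X
    using mult cube_group_closed face_filtration_insert[OF N] face_closed
      face_filtration_carrier[OF N A(2)] by blast+
  then have "(\<lambda>X. ?g X \<otimes> (F X \<otimes> F' X) \<otimes> inv ?g X) =
      (\<lambda>X. (?g X \<otimes> F X \<otimes> inv ?g X) \<otimes> (?g X \<otimes> F' X \<otimes> inv ?g X))"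
    by (intro ext) (simp add: m_assoc inv_solve_left)
  then show ?case using cube_group.mult[OF mult.IH] by simp
qed

lemma conj_cube_group:
  assumes N: "face_filtration N" and F: "F \<in> cube_group G V N"
    and F': "F' \<in> cube_group G V (\<lambda>A. N (insert v A))"
  shows "(\<lambda>X. F X \<otimes> F' X \<otimes> inv (F X)) \<in> cube_group G V (\<lambda>A. N (insert v A))"
  using F F'
proof (induction arbitrary: F' rule: cube_group.induct)
  case (face A g)
  then show ?case using conj_face_cube_group[OF N] by blast
next
  case (mult F1 F2)
  have "F1 X \<in> carrier G" "F2 X \<in> carrier G" "F' X \<in> carrier G" for X
    using mult cube_group_closed face_filtration_insert[OF N] N by blast+
  then have "(\<lambda>X. F1 X \<otimes> F2 X \<otimes> F' X \<otimes> inv (F1 X \<otimes> F2 X)) =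
    (\<lambda>X. F1 X \<otimes> (F2 X \<otimes> F' X \<otimes> inv (F2 X)) \<otimes> inv (F1 X))"
    by (intro ext) (simp add: m_assoc inv_mult_group)
  then show ?case using mult.IH(1)[OF mult.IH(2)[OF mult.prems]] by simp
qed

definition cube_derivative :: "'i \<Rightarrow> ('i set \<Rightarrow> 'a) \<Rightarrow> 'i set \<Rightarrow> 'a" where
  "cube_derivative v F X = F (insert v X) \<otimes> inv (F (X - {v}))"

lemma cube_group_restrict:
  assumes "face_filtration N" "F \<in> cube_group G (insert v W) N"
  shows "(\<lambda>X. F (X - {v})) \<in> cube_group G W N"
  using assms(2)
proof (induction rule: cube_group.induct)
  case (face A g)
  then show ?case
    using one_in_cube_group[OF assms(1), of W] cube_group.face[of A W g N G]
    by (cases "v \<in> A") (auto simp: face_Diff)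
qed (rule cube_group.mult)

lemma cube_derivative_in_cube_group:
  assumes N: "face_filtration N" and F: "F \<in> cube_group G (insert v W) N"
  shows "cube_derivative v F \<in> cube_group G W (\<lambda>A. N (insert v A))"
  using F
proof (induction rule: cube_group.induct)
  case (face A g)
  have g: "g \<in> carrier G" using face face_filtration_carrier[OF N] by blast
  show ?case
  proof (cases "v \<in> A")
    case True
    then have "cube_derivative v (face G A g) = face G (A - {v}) g"
      using g by (simp add: cube_derivative_def fun_eq_iff face_insert face_Diff face_closed)
    moreover have "insert v (A - {v}) = A" using True by blast
    ultimately show ?thesis
      using face cube_group.face[of "A - {v}" W g "\<lambda>A. N (insert v A)" G] by auto
  next
    case False
    then have "cube_derivative v (face G A g) = (\<lambda>X. \<one>)"
      using g by (simp add: cube_derivative_def fun_eq_iff face_insert face_Diff face_closed)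
    then show ?thesis using one_in_cube_group[OF face_filtration_insert[OF N]] by simp
  qed
next
  case (mult F1 F2)
  have "F1 X \<in> carrier G" "F2 X \<in> carrier G" for X using mult cube_group_closed N by blast+
  then have "cube_derivative v (\<lambda>X. F1 X \<otimes> F2 X) = (\<lambda>X. cube_derivative v F1 X \<otimes>
      (F1 (X - {v}) \<otimes> cube_derivative v F2 X \<otimes> inv (F1 (X - {v}))))"
    by (intro ext) (simp add: cube_derivative_def m_assoc inv_mult_group inv_solve_left)
  then show ?case
    using conj_cube_group[OF N cube_group_restrict[OF N mult.hyps(1)] mult.IH(2)] mult.IH(1)
    by (simp add: cube_group.mult)
qed

lemma cube_group_top:
  assumes "finite V" "face_filtration N" "F \<in> cube_group G V N" "\<And>X. X \<subset> V \<Longrightarrow> F X = \<one>"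
  shows "F V \<in> N V"
  using assms
proof (induction V arbitrary: F N rule: finite_induct)
  case empty
  note subgroup = face_filtration_subgroup[OF empty(1)]
  from empty(2) show ?case
    by (induction rule: cube_group.induct)
      (auto simp: face_def intro: subgroup.m_closed[OF subgroup])
next
  case (insert v W)
  have derivative: "cube_derivative v F \<in> cube_group G W (\<lambda>A. N (insert v A))"
    using cube_derivative_in_cube_group[OF insert.prems(1,2)] .
  have "cube_derivative v F W \<in> N (insert v W)"
  proof (rule insert.IH[OF face_filtration_insert[OF insert.prems(1)] derivative])
    fix X assume "X \<subset> W"
    then have "insert v X \<subset> insert v W" "X - {v} \<subset> insert v W" using insert.hyps(2) by auto
    then show "cube_derivative v F X = \<one>"
      using insert.prems(3) by (simp add: cube_derivative_def)
  qed
  moreover have "W - {v} = W" "W \<subset> insert v W" using insert.hyps by blast+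
  then have "cube_derivative v F W = F (insert v W)"
    using insert.prems(3)[of W] cube_group_closed[OF insert.prems(2,1)]
    by (simp add: cube_derivative_def)
  ultimately show ?case by simp
qed

lemma cube_group_if_depends_above_face:
  assumes "finite A" "A \<union> B \<subseteq> V" "\<And>X. \<phi> X \<in> carrier G" "\<And>X. \<phi> X = \<phi> (X \<inter> A)"
    and "\<And>C. C \<subseteq> A \<Longrightarrow> N (B \<union> C) = carrier G"
  shows "(\<lambda>X. face G B (\<phi> X) X) \<in> cube_group G V N"
  using assms
proof (induction A arbitrary: B \<phi> rule: finite_induct)
  case empty
  define g where "g = \<phi> {}"
  have \<phi>_eq: "\<phi> X = g" for X using empty.prems(3)[of X] by (simp add: g_def)
  have "B \<subseteq> V" using empty.prems(1) by simp
  moreover have "g \<in> N B" using empty.prems(2)[of "{}"] empty.prems(4)[of "{}"] by (simp add: g_def)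
  ultimately show ?case unfolding \<phi>_eq by (rule cube_group.face)
next
  case (insert v A)
  have "insert v X \<inter> insert v A = insert v (X \<inter> A) \<inter> insert v A"
    "(X - {v}) \<inter> insert v A = (X \<inter> A - {v}) \<inter> insert v A" for X
    by auto
  then have depends: "\<phi> (insert v X) = \<phi> (insert v (X \<inter> A))" "\<phi> (X - {v}) = \<phi> (X \<inter> A - {v})" for X
    using insert.prems(3) by metis+
  have "(\<lambda>X. face G (insert v B) (cube_derivative v \<phi> X) X) \<in> cube_group G V N"
  proof (rule insert.IH)
    show "cube_derivative v \<phi> X = cube_derivative v \<phi> (X \<inter> A)" for X
      unfolding cube_derivative_def using depends by metis
    show "N (insert v B \<union> C) = carrier G" if "C \<subseteq> A" for C
      using insert.prems(4)[of "insert v C"] that by (simp add: subset_insertI2)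
  qed (use insert.prems in \<open>auto simp: cube_derivative_def\<close>)
  moreover have "(\<lambda>X. face G B (\<phi> (X - {v})) X) \<in> cube_group G V N"
  proof (rule insert.IH)
    show "\<phi> (X - {v}) = \<phi> (X \<inter> A - {v})" for X by (rule depends)
    show "N (B \<union> C) = carrier G" if "C \<subseteq> A" for C using insert.prems(4)[of C] that by blast
  qed (use insert.prems in auto)
  moreover have "face G B (\<phi> X) X =
      face G (insert v B) (cube_derivative v \<phi> X) X \<otimes> face G B (\<phi> (X - {v})) X" for X
    using insert.prems(2)
    by (cases "v \<in> X") (auto simp: face_def cube_derivative_def m_assoc insert_absorb)
  ultimately show ?case by (simp add: cube_group.mult)
qed

lemma cube_group_if_junta:
  assumes "junta V r \<phi>" "\<And>X. \<phi> X \<in> carrier G" "\<And>A. card A \<le> r \<Longrightarrow> N A = carrier G"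
  shows "\<phi> \<in> cube_group G V N"
proof -
  obtain A where A: "A \<subseteq> V" "finite A" "card A \<le> r" "\<And>X. \<phi> X = \<phi> (X \<inter> A)"
    using assms(1) unfolding junta_def by blast
  have "(\<lambda>X. face G {} (\<phi> X) X) \<in> cube_group G V N"
  proof (rule cube_group_if_depends_above_face[OF A(2)])
    show "N ({} \<union> C) = carrier G" if "C \<subseteq> A" for C
      using assms(3) card_mono[OF A(2) that] A(3) by simp
  qed (use A assms(2) in auto)
  then show ?thesis by (simp add: face_def)
qed

text \<open>The exponential weights make \<open>[\<gamma>\<^sub>i, \<gamma>\<^sub>j] \<subseteq> \<gamma>\<^bsub>max i j + 1\<^esub>\<close> sufficient for the commutator
  condition, which avoids the sharper \<open>[\<gamma>\<^sub>i, \<gamma>\<^sub>j] \<subseteq> \<gamma>\<^bsub>i + j\<^esub>\<close>.\<close>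

definition central_faces :: "nat \<Rightarrow> 'i set \<Rightarrow> 'a set" where
  "central_faces r A =
    {g \<in> carrier G. \<forall>w. r * 2 ^ w < card A \<longrightarrow> g \<in> lower_central G (Suc w)}"

lemma central_faces_Un:
  assumes "g \<in> central_faces r A" "h \<in> central_faces r B" "r * 2 ^ w < card (A \<union> B)"
  shows "g \<in> lower_central G w \<or> h \<in> lower_central G w"
proof (cases w)
  case 0
  then show ?thesis using assms(1) by (simp add: central_faces_def)
next
  case (Suc w')
  then have "r * 2 ^ w' < card A \<or> r * 2 ^ w' < card B"
    using assms(3) card_Un_le[of A B] by auto
  then show ?thesis
    using assms(1,2) unfolding Suc central_faces_def by blast
qed

lemma face_filtration_central_faces: "face_filtration (central_faces r)"
  unfolding face_filtration_def
proof (intro conjI allI ballI)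
  fix A :: "'i set"
  show "subgroup (central_faces r A) G"
    by (rule subgroupI)
      (auto simp: central_faces_def simp del: lower_central.simps
        intro: subgroup.one_closed subgroup.m_closed subgroup.m_inv_closed lower_central_subgroup)
next
  fix A B :: "'i set" and g h
  assume g: "g \<in> central_faces r A" and h: "h \<in> central_faces r B"
  then have carrier: "g \<in> carrier G" "h \<in> carrier G" by (auto simp: central_faces_def)
  then have "group_commutator G g h \<in> lower_central G (Suc w)" if "r * 2 ^ w < card (A \<union> B)" for w
    using central_faces_Un[OF g h that] group_commutator_lower_central by blast
  then show "group_commutator G g h \<in> central_faces r (A \<union> B)"
    using carrier by (simp add: central_faces_def del: lower_central.simps)
qed

lemma central_faces_small:
  assumes "card A \<le> r" shows "central_faces r A = carrier G"
proof -
  have "r \<le> r * 2 ^ w" for w by simp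
  then have "\<not> r * 2 ^ w < card A" for w using assms by (meson le_trans not_le)
  then show ?thesis by (simp add: central_faces_def)
qed

lemma cube_group_term_condition:
  assumes c: "lower_central G c = {\<one>}" and W: "finite W" "v \<notin> W" "r * 2 ^ c \<le> card W"
    and F: "F \<in> cube_group G (insert v W) (central_faces r)"
  shows "term_condition v W F"
  unfolding term_condition_def
proof
  assume eq: "\<forall>X. X \<subset> W \<longrightarrow> F X = F (insert v X)"
  note filtration = face_filtration_central_faces[of r]
  have closed: "F X \<in> carrier G" for X using cube_group_closed[OF F filtration] .
  have "cube_derivative v F W \<in> central_faces r (insert v W)"
  proof (rule cube_group_top[OF W(1) face_filtration_insert[OF filtration]
        cube_derivative_in_cube_group[OF filtration F]])
    fix X assume X: "X \<subset> W"
    then have "X - {v} = X" using W(2) by blast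
    then show "cube_derivative v F X = \<one>" using eq X closed by (simp add: cube_derivative_def)
  qed
  moreover have "r * 2 ^ c < card (insert v W)" using W by simp
  ultimately have "cube_derivative v F W \<in> lower_central G (Suc c)"
    unfolding central_faces_def by blast
  then have "cube_derivative v F W = \<one>" using lower_central_Suc_subset[of c] c by blast
  moreover have "W - {v} = W" using W(2) by blast
  ultimately have "F (insert v W) \<otimes> inv (F W) = \<one>" by (simp add: cube_derivative_def)
  then show "F W = F (insert v W)"
    using closed inv_solve_right'[of \<one> "F (insert v W)" "F W"] by simp
qed

end

subsection \<open>Supernilpotent extensions\<close>

context completely_simple_ideal
begin

lemma group_coordinate_in_cube_group:
  assumes m: "1 \<le> m" "sg_power m \<subseteq> K" and F: "F \<in> cube_words n"
  shows "(\<lambda>X. e * F X * e) \<in> cube_group G {..<n} (G.central_faces (m + m))"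
  using F
proof (induction rule: cube_words.induct)
  case (gen i b a)
  have "junta {..<n} 1 (\<lambda>X. e * (if i \<in> X then b else a) * e)"
    using gen junta_indicator[of i "{..<n}" b a]
    by (intro junta_compose[where h = "\<lambda>x. e * x * e"]) simp
  then have "junta {..<n} (m + m) (\<lambda>X. e * (if i \<in> X then b else a) * e)"
    using m(1) by (elim junta_mono) simp
  then show ?case by (rule G.cube_group_if_junta) (simp_all add: G.central_faces_small)
next
  case (mult F F')
  have "junta {..<n} (m + m) (\<lambda>X. (J (F X) * F X) * (F' X * J (F' X)))"
    using columns.junta_coordinate[OF m mult.hyps(1)] rows.junta_coordinate[OF m mult.hyps(2)]
    by (rule junta_compose2)
  then have "(\<lambda>X. (J (F X) * F X) * (F' X * J (F' X)))
      \<in> cube_group G {..<n} (G.central_faces (m + m))"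
    by (rule G.cube_group_if_junta) (simp_all add: G.central_faces_small H_iff mult.assoc)
  from cube_group.mult[OF cube_group.mult[OF mult.IH(1) this] mult.IH(2)]
  show ?case by (simp add: mult.assoc)
qed

lemma term_condition_cube_words:
  fixes F :: "nat set \<Rightarrow> 'a"
  assumes m: "1 \<le> m" "sg_power m \<subseteq> K" and c: "lower_central G c = {e}"
    and d: "(m + m) * 2 ^ c \<le> d" and F: "F \<in> cube_words (Suc d)"
  shows "term_condition d {..<d} F"
  unfolding term_condition_def
proof
  assume eq: "\<forall>X. X \<subset> {..<d} \<longrightarrow> F X = F (insert d X)"
  have transfer: "h (F {..<d}) = h (F (insert d {..<d}))"
    if "term_condition d {..<d} (\<lambda>X. h (F X))" for h :: "'a \<Rightarrow> 'a"
    using that eq unfolding term_condition_def by simp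
  have "m + m \<le> (m + m) * 2 ^ c" by simp
  then have "m + m \<le> d" using d by (rule order_trans)
  then have card: "m < card {..<d}" using m(1) by simp
  show "F {..<d} = F (insert d {..<d})"
  proof (cases "range F \<subseteq> K")
    case False
    then have "junta {..<Suc d} m F" using rows.junta_or_range_subset[OF m F] by blast
    then have "term_condition d {..<d} F" using card by (rule junta_term_condition) simp
    then show ?thesis using transfer[of id] by simp
  next
    case True
    have "insert d {..<d} = {..<Suc d}" by auto
    then have "term_condition d {..<d} (\<lambda>X. e * F X * e)"
      using G.cube_group_term_condition[of c "{..<d}" d "m + m"] c d
        group_coordinate_in_cube_group[OF m F] by simp
    note group = transfer[of "\<lambda>a. e * a * e", OF this]
    have "term_condition d {..<d} (\<lambda>X. F X * J (F X))"
      using rows.junta_coordinate[OF m F] card by (rule junta_term_condition) simp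
    note row = transfer[of "\<lambda>a. a * J a", OF this]
    have "term_condition d {..<d} (\<lambda>X. J (F X) * F X)"
      using columns.junta_coordinate[OF m F] card by (rule junta_term_condition) simp
    note column = transfer[of "\<lambda>a. J a * a", OF this]
    show ?thesis
      by (rule rees_coordinates_inject[OF _ _ row group column]) (use True in auto)
  qed
qed

lemma sg_supernilpotent_if_nilpotent:
  assumes "nilpotent_extension K" "nilpotent_group G" shows "sg_supernilpotent TYPE('a)"
proof -
  obtain m where m: "1 \<le> m" "sg_power m \<subseteq> K"
    using assms(1) unfolding nilpotent_extension_def by blast
  obtain c where c: "lower_central G c = {e}"
    using assms(2) unfolding nilpotent_group_def by auto
  have "commutator (replicate (Suc ((m + m) * 2 ^ c)) UNIV) = (Id :: 'a rel)"
    unfolding commutator_replicate_eq_Id_iff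
    using term_condition_cube_words[OF m c order_refl] by blast
  then show ?thesis unfolding sg_supernilpotent_def by blast
qed

end

subsection \<open>Nilpotent extensions from solvability and supernilpotence\<close>

definition nilpotent_extension_modulo :: "('a::semigroup_mult) set \<Rightarrow> 'a rel \<Rightarrow> bool" where
  "nilpotent_extension_modulo K \<alpha> \<longleftrightarrow> (\<exists>k. \<forall>s \<in> sg_power (Suc k). \<exists>c \<in> K. (s, c) \<in> \<alpha>)"

context completely_simple_ideal
begin

lemma local_identity:
  assumes "a \<in> K" "b \<in> K" shows "\<exists>f \<in> K. a * f = a \<and> f * b = b"
proof (intro bexI conjI)
  let ?f = "b * J (a * b) * a"
  have "a * ?f = (a * b * J (a * b)) * a" by (simp add: mult.assoc)
  then show "a * ?f = a"
    unfolding row_coordinate_mult[OF assms(1)] using J_regular[OF assms(1)] by simp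
  have "?f * b = b * (J (a * b) * (a * b))" by (simp add: mult.assoc)
  then show "?f * b = b"
    unfolding column_coordinate_mult[OF assms(2)] using J_regular_simps(1)[OF assms(2)] by simp
  show "?f \<in> K" using assms(1) by (rule K_left)
qed

lemma nilpotent_extension_modulo_bcomm:
  assumes \<alpha>: "sg_congruence \<alpha>" "nilpotent_extension_modulo K \<alpha>"
    and \<beta>: "sg_congruence \<beta>" "nilpotent_extension_modulo K \<beta>"
  shows "nilpotent_extension_modulo K (bcomm \<alpha> \<beta>)"
proof -
  note bcomm = sg_congruence_commutator[of "[\<alpha>, \<beta>]"]
  obtain k l where k: "\<And>s. s \<in> sg_power (Suc k) \<Longrightarrow> \<exists>c \<in> K. (s, c) \<in> \<alpha>"
    and l: "\<And>s. s \<in> sg_power (Suc l) \<Longrightarrow> \<exists>c \<in> K. (s, c) \<in> \<beta>"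
    using \<alpha>(2) \<beta>(2) unfolding nilpotent_extension_modulo_def by blast
  have "\<exists>c \<in> K. (s, c) \<in> bcomm \<alpha> \<beta>" if s: "s \<in> sg_power (Suc k + Suc l)" for s
  proof -
    obtain a b where ab: "s = a * b" "a \<in> sg_power (Suc k)" "b \<in> sg_power (Suc l)"
      using sg_power_split[OF s] by blast
    obtain a' b' where a': "a' \<in> K" "(a, a') \<in> \<alpha>" and b': "b' \<in> K" "(b, b') \<in> \<beta>"
      using k l ab(2,3) by blast
    obtain f where f: "f \<in> K" "a' * f = a'" "f * b' = b'"
      using local_identity[OF a'(1) b'(1)] by blast
    have "(f * b, b') \<in> \<beta>" using sg_congruence_mult_left[OF \<beta>(1) b'(2), of f] f(3) by simp
    then have "(f * b, b) \<in> \<beta>"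
      using sg_congruence_trans[OF \<beta>(1) _ sg_congruence_sym[OF \<beta>(1) b'(2)]] by blast
    with sg_congruence_sym[OF \<alpha>(1) a'(2)]
    have "commutator_matrix \<alpha> \<beta> (a' * (f * b)) (a' * b) (a * (f * b)) (a * b)"
      by (intro commutator_matrix.intros)
    moreover have "a' * (f * b) = a' * b" using f(2) by (metis mult.assoc)
    ultimately have "(a * (f * b), a * b) \<in> bcomm \<alpha> \<beta>"
      using bcomm_commutator_matrix sg_congruence_refl[OF bcomm] by metis
    then have "(s, a * (f * b)) \<in> bcomm \<alpha> \<beta>" unfolding ab(1) by (rule sg_congruence_sym[OF bcomm])
    moreover have "a * (f * b) \<in> K" using f(1) K_left K_right by blast
    ultimately show ?thesis by blast
  qed
  then show ?thesis
    unfolding nilpotent_extension_modulo_def by (intro exI[of _ "Suc k + l"]) simp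
qed

lemma nilpotent_extension_modulo_iterated_commutator:
  "iterated_commutator \<alpha> \<Longrightarrow> nilpotent_extension_modulo K \<alpha>"
proof (induction rule: iterated_commutator.induct)
  case UNIV
  then show ?case using e_in_K by (auto simp: nilpotent_extension_modulo_def)
next
  case (bcomm \<alpha> \<beta>)
  then show ?case
    by (intro nilpotent_extension_modulo_bcomm sg_congruence_iterated_commutator)
qed

lemma nilpotent_extension_if_iterated_commutator_Id:
  assumes "iterated_commutator (Id :: 'a rel)" shows "nilpotent_extension K"
proof -
  obtain k where "sg_power (Suc k) \<subseteq> K"
    using nilpotent_extension_modulo_iterated_commutator[OF assms]
    unfolding nilpotent_extension_modulo_def by blast
  then show ?thesis unfolding nilpotent_extension_def by (intro exI[of _ "Suc k"]) simp
qed

definition absorbing_word :: "nat \<Rightarrow> 'a \<Rightarrow> (nat set \<Rightarrow> 'a) \<Rightarrow> 'a \<Rightarrow> bool" where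
  "absorbing_word k s F h \<longleftrightarrow> F \<in> cube_words (Suc k) \<and> h \<in> K \<and>
    (\<forall>X. {..k} \<subseteq> X \<longrightarrow> F X = s) \<and> (\<forall>X. \<not> {..k} \<subseteq> X \<longrightarrow> F X * h = F X) \<and>
    (\<forall>X. X \<subset> {..<k} \<longrightarrow> F X = F (insert k X))"

text \<open>Each factor \<open>s\<^sub>i\<close> is paired with \<open>h\<^sub>i\<^sub>-\<^sub>1 s\<^sub>i\<close>, where \<open>h\<^sub>i\<close> is a right identity of
  \<open>h\<^sub>i\<^sub>-\<^sub>1 s\<^sub>i\<close>. Once some factor is replaced, all later \<open>h\<^sub>i\<close> may be inserted freely.\<close>

lemma absorbing_word_Suc:
  assumes "absorbing_word k s F h"
  shows "absorbing_word (Suc k) (s * t)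
    (\<lambda>X. F X * (if Suc k \<in> X then t else h * t)) (J (h * t) * (h * t))"
    (is "absorbing_word _ _ ?F ?h")
proof -
  have F: "F \<in> cube_words (Suc k)" and h: "h \<in> K"
    and top: "\<And>X. {..k} \<subseteq> X \<Longrightarrow> F X = s" and absorb: "\<And>X. \<not> {..k} \<subseteq> X \<Longrightarrow> F X * h = F X"
    using assms by (auto simp: absorbing_word_def)
  have "?F \<in> cube_words (Suc (Suc k))"
    using cube_words_mono[OF F, of "Suc (Suc k)"] by (intro cube_words.intros) auto
  moreover have "?h \<in> K" using h K_left K_right by blast
  moreover have "?F X = s * t" if "{..Suc k} \<subseteq> X" for X
    using that top[of X] by (auto simp: atMost_Suc)
  moreover have "?F X * ?h = ?F X" if X: "\<not> {..Suc k} \<subseteq> X" for X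
  proof -
    have "?F X = F X * (h * t)"
      using X absorb[of X] by (auto simp: atMost_Suc mult.assoc[symmetric])
    moreover have "h * t * ?h = h * t" using J_regular_simps(1)[OF K_right[OF h]] .
    ultimately show ?thesis by (simp only: mult.assoc)
  qed
  moreover have "?F X = ?F (insert (Suc k) X)" if X: "X \<subset> {..<Suc k}" for X
  proof -
    have "insert (Suc k) X \<inter> {..<Suc k} = X \<inter> {..<Suc k}" by auto
    then have "F (insert (Suc k) X) = F X" using cube_words_Int[OF F] by metis
    moreover have "\<not> {..k} \<subseteq> X" "Suc k \<notin> X" using X by (auto simp: lessThan_Suc_atMost)
    ultimately show ?thesis using absorb[of X] by (simp add: mult.assoc[symmetric])
  qed
  ultimately show ?thesis unfolding absorbing_word_def by blast
qed

lemma absorbing_word_exists: "s \<in> sg_power (Suc k) \<Longrightarrow> \<exists>F h. absorbing_word k s F h"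
proof (induction k arbitrary: s)
  case 0
  have "(\<lambda>X. if 0 \<in> X then s else e) \<in> cube_words (Suc 0)" by (rule cube_words.gen) simp
  then have "absorbing_word 0 s (\<lambda>X. if 0 \<in> X then s else e) e"
    using e_in_K by (simp add: absorbing_word_def)
  then show ?case by blast
next
  case (Suc k)
  then obtain s' t where "s = s' * t" "s' \<in> sg_power (Suc k)" by auto
  then show ?case using Suc.IH absorbing_word_Suc by blast
qed

lemma nilpotent_extension_if_sg_supernilpotent:
  assumes "sg_supernilpotent TYPE('a)" shows "nilpotent_extension K"
proof -
  obtain d where d: "commutator (replicate (Suc d) UNIV) = (Id :: 'a rel)"
    using assms unfolding sg_supernilpotent_def by blast
  have "s \<in> K" if s: "s \<in> sg_power (Suc d)" for s
  proof -
    obtain F h where word: "absorbing_word d s F h" using absorbing_word_exists[OF s] by blast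
    then have "term_condition d {..<d} F"
      using d unfolding commutator_replicate_eq_Id_iff absorbing_word_def by blast
    then have "F {..<d} = F (insert d {..<d})"
      using word unfolding term_condition_def absorbing_word_def by blast
    also have "insert d {..<d} = {..d}" by auto
    also have "F {..d} = s" using word unfolding absorbing_word_def by blast
    finally have "F {..<d} = s" .
    moreover have "\<not> {..d} \<subseteq> {..<d}" by auto
    ultimately have "s * h = s" "h \<in> K" using word unfolding absorbing_word_def by metis+
    then show ?thesis using K_left[of h s] by simp
  qed
  then show ?thesis
    unfolding nilpotent_extension_def by (intro exI[of _ "Suc d"]) (auto simp del: sg_power.simps)
qed

end

subsection \<open>Subgroups\<close>

locale subgroup_of_semigroup =
  fixes H :: "('a::semigroup_mult) set" and e :: 'a
  assumes group: "group (sub_group_monoid H e)"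
begin

abbreviation P :: "'a monoid" where "P \<equiv> sub_group_monoid H e"

sublocale P: group P by (rule group)

lemma H_simps [simp]:
  "e \<in> H" "x \<in> H \<Longrightarrow> e * x = x" "x \<in> H \<Longrightarrow> x * e = x" "x \<in> H \<Longrightarrow> inv\<^bsub>P\<^esub> x \<in> H"
  "x \<in> H \<Longrightarrow> y \<in> H \<Longrightarrow> x * y \<in> H"
  "x \<in> H \<Longrightarrow> x * inv\<^bsub>P\<^esub> x = e" "x \<in> H \<Longrightarrow> inv\<^bsub>P\<^esub> x * x = e"
  using P.one_closed P.l_one[of x] P.r_one[of x] P.inv_closed[of x] P.m_closed[of x y]
    P.r_inv[of x] P.l_inv[of x] by auto

definition class_of_one :: "'a rel \<Rightarrow> 'a set" where
  "class_of_one \<alpha> = {h \<in> H. (e, h) \<in> \<alpha>}"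

lemma class_of_one_Id: "class_of_one Id \<subseteq> {e}"
  by (auto simp: class_of_one_def)

lemma class_of_one_UNIV: "class_of_one UNIV = H"
  by (auto simp: class_of_one_def)

lemma subgroup_class_of_one:
  assumes "sg_congruence \<alpha>" shows "subgroup (class_of_one \<alpha>) P"
proof (rule P.subgroupI)
  show "class_of_one \<alpha> \<noteq> {}"
    using sg_congruence_refl[OF assms, of e] H_simps(1) unfolding class_of_one_def by blast
  fix a assume "a \<in> class_of_one \<alpha>"
  then have a: "a \<in> H" "(e, a) \<in> \<alpha>" by (auto simp: class_of_one_def)
  have "(inv\<^bsub>P\<^esub> a, e) \<in> \<alpha>"
    using sg_congruence_mult_right[OF assms a(2), of "inv\<^bsub>P\<^esub> a"] a(1) by simp
  then show "inv\<^bsub>P\<^esub> a \<in> class_of_one \<alpha>"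
    using sg_congruence_sym[OF assms] a(1) by (simp add: class_of_one_def)
  fix b assume "b \<in> class_of_one \<alpha>"
  then have b: "b \<in> H" "(e, b) \<in> \<alpha>" by (auto simp: class_of_one_def)
  show "a \<otimes>\<^bsub>P\<^esub> b \<in> class_of_one \<alpha>"
    using sg_congruence_mult[OF assms a(2) b(2)] a(1) b(1) by (simp add: class_of_one_def)
qed (auto simp: class_of_one_def)

lemma group_commutator_in_bcomm:
  assumes \<alpha>: "sg_congruence \<alpha>" and \<beta>: "sg_congruence \<beta>"
    and g: "g \<in> class_of_one \<alpha>" and h: "h \<in> class_of_one \<beta>"
  shows "group_commutator P g h \<in> class_of_one (bcomm \<alpha> \<beta>)"
    and "group_commutator P h g \<in> class_of_one (bcomm \<alpha> \<beta>)"
proof -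
  note bcomm = sg_congruence_commutator[of "[\<alpha>, \<beta>]"]
  let ?g = "inv\<^bsub>P\<^esub> g" and ?h = "inv\<^bsub>P\<^esub> h"
  have H: "g \<in> H" "h \<in> H" using g h by (auto simp: class_of_one_def)
  have "commutator_matrix \<alpha> \<beta>
      (e * e * e * e) (e * h * e * ?h) (g * e * ?g * e) (g * h * ?g * ?h)"
    using g h subgroup.m_inv_closed[OF subgroup_class_of_one[OF \<alpha>] g]
      subgroup.m_inv_closed[OF subgroup_class_of_one[OF \<beta>] h]
    by (intro commutator_matrix.intros) (auto simp: class_of_one_def)
  then have "commutator_matrix \<alpha> \<beta> e e e (g * h * ?g * ?h)" using H by simp
  then have "(e, g * h * ?g * ?h) \<in> bcomm \<alpha> \<beta>"
    using sg_congruence_refl[OF bcomm] by (rule bcomm_commutator_matrix)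
  then show gh: "group_commutator P g h \<in> class_of_one (bcomm \<alpha> \<beta>)"
    using H by (simp add: class_of_one_def)
  show "group_commutator P h g \<in> class_of_one (bcomm \<alpha> \<beta>)"
    using subgroup.m_inv_closed[OF subgroup_class_of_one[OF bcomm] gh]
      P.inv_group_commutator[of g h] H by simp
qed

lemma derived_series_subset: "(derived P ^^ d) H \<subseteq> class_of_one (derived_pow d)"
proof (induction d)
  case (Suc d)
  note congruence = sg_congruence_derived_pow[of d]
  have "derived_set P ((derived P ^^ d) H) \<subseteq> class_of_one (derived_pow (Suc d))"
    using group_commutator_in_bcomm(1)[OF congruence congruence] Suc by auto
  then show ?case
    unfolding funpow.simps o_apply derived_def
    by (intro P.generate_subgroup_incl subgroup_class_of_one sg_congruence_derived_pow)
qed (simp add: class_of_one_UNIV)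

lemma lower_central_subset:
  assumes S: "central_series S" shows "lower_central P d \<subseteq> class_of_one (S d)"
proof (induction d)
  case 0
  then show ?case using S by (simp add: central_series_def class_of_one_UNIV)
next
  case (Suc d)
  have "group_commutator P g h \<in> class_of_one (S (Suc d))"
    if "g \<in> H" and h: "h \<in> class_of_one (S d)" for g h
  proof -
    have g: "g \<in> class_of_one UNIV" using that(1) by (simp add: class_of_one_UNIV)
    note congruence = sg_congruence_central_series[OF S, of d]
    have "group_commutator P g h \<in> class_of_one (bcomm UNIV (S d))"
      "group_commutator P g h \<in> class_of_one (bcomm (S d) UNIV)"
      using group_commutator_in_bcomm(1)[OF sg_congruence_UNIV congruence g h]
        group_commutator_in_bcomm(2)[OF congruence sg_congruence_UNIV h g] by blast+
    moreover have "S (Suc d) = bcomm UNIV (S d) \<or> S (Suc d) = bcomm (S d) UNIV"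
      using S by (simp add: central_series_def)
    ultimately show ?thesis by metis
  qed
  then show ?case
    unfolding lower_central.simps using Suc
    by (intro P.generate_subgroup_incl subgroup_class_of_one sg_congruence_central_series S) auto
qed

lemma solvable_if_sg_solvable:
  assumes "sg_solvable TYPE('a)" shows "solvable P"
proof -
  obtain d where "derived_pow d = (Id :: 'a rel)"
    using assms unfolding sg_solvable_def by blast
  then have "(derived P ^^ d) H \<subseteq> {e}"
    using derived_series_subset[of d] class_of_one_Id by simp
  moreover have "e \<in> (derived P ^^ d) H"
    using subgroup.one_closed[OF P.exp_of_derived_is_subgroup[OF P.subgroup_self, of d]] by simp
  ultimately have "(derived P ^^ d) (carrier P) = {\<one>\<^bsub>P\<^esub>}" by auto
  then show ?thesis using P.solvable_iff_trivial_derived_seq by blast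
qed

lemma nilpotent_group_if_central_series:
  assumes "central_series S" "S d = (Id :: 'a rel)" shows "nilpotent_group P"
  using lower_central_subset[OF assms(1), of d] class_of_one_Id assms(2)
  by (intro P.nilpotent_groupI[of d]) simp

text \<open>\<open>cube_words\<close> need not be closed under inverses, hence the condition on \<open>inv h\<close>.\<close>

definition top_values :: "nat \<Rightarrow> 'a set" where
  "top_values k = {h \<in> H. face P {..k} h \<in> cube_words (Suc k) \<and>
     face P {..k} (inv\<^bsub>P\<^esub> h) \<in> cube_words (Suc k)}"

lemma top_valuesI:
  "h \<in> H \<Longrightarrow> face P {..k} h \<in> cube_words (Suc k) \<Longrightarrow>
    face P {..k} (inv\<^bsub>P\<^esub> h) \<in> cube_words (Suc k) \<Longrightarrow> h \<in> top_values k"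
  by (simp add: top_values_def)

lemma top_valuesD:
  assumes "h \<in> top_values k"
  shows "h \<in> H" and "face P {..k} h \<in> cube_words (Suc k)"
    and "face P {..k} (inv\<^bsub>P\<^esub> h) \<in> cube_words (Suc k)"
  using assms by (simp_all add: top_values_def)

lemma face_P: "face P A h = (\<lambda>X. if A \<subseteq> X then h else e)"
  by (simp add: face_def fun_eq_iff)

lemma face_mult_in_cube_words:
  assumes "face P A g \<in> cube_words n" "face P A h \<in> cube_words n"
  shows "face P A (g * h) \<in> cube_words n"
proof -
  have "face P A (g * h) = (\<lambda>X. face P A g X * face P A h X)" by (simp add: face_P fun_eq_iff)
  then show ?thesis using cube_words.mult[OF assms] by simp
qed

lemma face_singleton_in_cube_words: "i < n \<Longrightarrow> face P {i} h \<in> cube_words n"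
  using cube_words.gen[of i n h e] by (simp add: face_P)

lemma subgroup_top_values: "subgroup (top_values k) P"
proof (rule P.subgroupI)
  have "face P {..k} e = face P {0} e" by (simp add: face_P)
  then have "face P {..k} e \<in> cube_words (Suc k)" by (simp add: face_singleton_in_cube_words)
  moreover have "inv\<^bsub>P\<^esub> e = e" using P.inv_one by simp
  ultimately have "e \<in> top_values k" by (intro top_valuesI) simp_all
  then show "top_values k \<noteq> {}" by blast
  fix a assume a: "a \<in> top_values k"
  then have "inv\<^bsub>P\<^esub> (inv\<^bsub>P\<^esub> a) = a" using P.inv_inv[of a] by (simp add: top_values_def)
  then show "inv\<^bsub>P\<^esub> a \<in> top_values k" using top_valuesD[OF a] by (intro top_valuesI) simp_all
  fix b assume b: "b \<in> top_values k"
  have "inv\<^bsub>P\<^esub> (a * b) = inv\<^bsub>P\<^esub> b * inv\<^bsub>P\<^esub> a"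
    using top_valuesD(1)[OF a] top_valuesD(1)[OF b] P.inv_mult_group[of a b] by simp
  then show "a \<otimes>\<^bsub>P\<^esub> b \<in> top_values k"
    using top_valuesD[OF a] top_valuesD[OF b]
    by (intro top_valuesI) (simp_all add: face_mult_in_cube_words)
qed (simp add: top_values_def)

lemma face_group_commutator_in_cube_words:
  assumes "g \<in> H" "h \<in> top_values k"
  shows "face P {..Suc k} (group_commutator P g h) \<in> cube_words (Suc (Suc k))"
    and "face P {..Suc k} (group_commutator P h g) \<in> cube_words (Suc (Suc k))"
proof -
  note h = top_valuesD[OF assms(2)]
  let ?g = "inv\<^bsub>P\<^esub> g" and ?h = "inv\<^bsub>P\<^esub> h"
  let ?F = "\<lambda>a. face P {Suc k} a" and ?F' = "\<lambda>a. face P {..k} a"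
  have words: "?F a \<in> cube_words (Suc (Suc k))" "?F' h \<in> cube_words (Suc (Suc k))"
    "?F' ?h \<in> cube_words (Suc (Suc k))" for a
    using face_singleton_in_cube_words cube_words_mono[OF h(2)] cube_words_mono[OF h(3)] by simp_all
  have "face P {..Suc k} (g * h * ?g * ?h) = (\<lambda>X. ?F g X * ?F' h X * ?F ?g X * ?F' ?h X)"
    "face P {..Suc k} (h * g * ?h * ?g) = (\<lambda>X. ?F' h X * ?F g X * ?F' ?h X * ?F ?g X)"
    using assms(1) h(1) by (auto simp: face_P atMost_Suc)
  then show "face P {..Suc k} (group_commutator P g h) \<in> cube_words (Suc (Suc k))"
    "face P {..Suc k} (group_commutator P h g) \<in> cube_words (Suc (Suc k))"
    using words by (simp_all add: cube_words.mult)
qed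

lemma group_commutator_in_top_values:
  assumes "g \<in> H" "h \<in> top_values k" shows "group_commutator P g h \<in> top_values (Suc k)"
  using face_group_commutator_in_cube_words[OF assms] P.inv_group_commutator[of g h]
    assms(1) top_valuesD(1)[OF assms(2)]
  by (intro top_valuesI) simp_all

lemma lower_central_subset_top_values: "lower_central P k \<subseteq> top_values k"
proof (induction k)
  case 0
  have "face P {..0} h \<in> cube_words (Suc 0)" for h
    using face_singleton_in_cube_words[of 0 "Suc 0" h] by simp
  then show ?case by (auto simp: top_values_def)
next
  case (Suc k)
  then show ?case
    unfolding lower_central.simps using group_commutator_in_top_values
    by (intro P.generate_subgroup_incl subgroup_top_values) auto
qed

lemma nilpotent_group_if_sg_supernilpotent:
  assumes "sg_supernilpotent TYPE('a)" shows "nilpotent_group P"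
proof -
  obtain d where d: "commutator (replicate (Suc d) UNIV) = (Id :: 'a rel)"
    using assms unfolding sg_supernilpotent_def by blast
  have "h = e" if h: "h \<in> lower_central P d" for h
  proof -
    have "face P {..d} h \<in> cube_words (Suc d)"
      using h lower_central_subset_top_values top_valuesD(2) by blast
    then have "term_condition d {..<d} (face P {..d} h)"
      using d unfolding commutator_replicate_eq_Id_iff by blast
    moreover have "face P {..d} h X = face P {..d} h (insert d X)" if X: "X \<subset> {..<d}" for X
    proof -
      obtain i where "i < d" "i \<notin> X" using X by auto
      then have "i \<in> {..d} - insert d X" by simp
      then have "\<not> {..d} \<subseteq> X" "\<not> {..d} \<subseteq> insert d X" by blast+
      then show ?thesis by (simp add: face_P)
    qed
    ultimately have "face P {..d} h {..<d} = face P {..d} h (insert d {..<d})"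
      unfolding term_condition_def by simp
    moreover have "insert d {..<d} = {..d}" "\<not> {..d} \<subseteq> {..<d}" by auto
    ultimately show ?thesis by (simp add: face_P)
  qed
  then show ?thesis by (intro P.nilpotent_groupI[of d]) auto
qed

end

abbreviation (input) all_subgroups :: "('a::semigroup_mult) set \<Rightarrow> ('a monoid \<Rightarrow> bool) \<Rightarrow> bool" where
  "all_subgroups K Q \<equiv>
    \<forall>H e. H \<subseteq> K \<and> group (sub_group_monoid H e) \<longrightarrow> Q (sub_group_monoid H e)"

context completely_simple_ideal
begin

lemma all_subgroups_G: "all_subgroups K Q \<Longrightarrow> Q G"
  using group_G H_subset_K by blast

lemma sg_solvable_iff:
  "sg_solvable TYPE('a) \<longleftrightarrow> nilpotent_extension K \<and> all_subgroups K solvable"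
proof
  assume solvable: "sg_solvable TYPE('a)"
  then obtain d where "derived_pow d = (Id :: 'a rel)" unfolding sg_solvable_def by blast
  then have "nilpotent_extension K"
    using nilpotent_extension_if_iterated_commutator_Id iterated_commutator_derived_pow by metis
  then show "nilpotent_extension K \<and> all_subgroups K solvable"
    using subgroup_of_semigroup.solvable_if_sg_solvable[OF _ solvable]
      subgroup_of_semigroup.intro by blast
qed (use sg_solvable_if_solvable all_subgroups_G in blast)

lemma central_series_eq_Id_iff:
  fixes S :: "nat \<Rightarrow> 'a rel"
  assumes "central_series S"
  shows "(\<exists>d. S d = Id) \<longleftrightarrow> nilpotent_extension K \<and> all_subgroups K nilpotent_group"
proof
  assume "\<exists>d. S d = Id"
  then obtain d where d: "S d = Id" ..
  then have "nilpotent_extension K"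
    using nilpotent_extension_if_iterated_commutator_Id
      iterated_commutator_central_series[OF assms] by metis
  then show "nilpotent_extension K \<and> all_subgroups K nilpotent_group"
    using subgroup_of_semigroup.nilpotent_group_if_central_series[OF _ assms d]
      subgroup_of_semigroup.intro by blast
next
  assume "nilpotent_extension K \<and> all_subgroups K nilpotent_group"
  then have "nilpotent_modulo (Id :: 'a rel)"
    using nilpotent_modulo_Id all_subgroups_G by blast
  then obtain d where "S d \<subseteq> Id" using assms unfolding nilpotent_modulo_def by blast
  then show "\<exists>d. S d = Id"
    using sg_congruence_eq_IdI[OF sg_congruence_central_series[OF assms]] by blast
qed

lemma sg_supernilpotent_iff:
  "sg_supernilpotent TYPE('a) \<longleftrightarrow> nilpotent_extension K \<and> all_subgroups K nilpotent_group"
proof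
  assume supernilpotent: "sg_supernilpotent TYPE('a)"
  then show "nilpotent_extension K \<and> all_subgroups K nilpotent_group"
    using nilpotent_extension_if_sg_supernilpotent subgroup_of_semigroup.intro
      subgroup_of_semigroup.nilpotent_group_if_sg_supernilpotent[OF _ supernilpotent] by blast
qed (use sg_supernilpotent_if_nilpotent all_subgroups_G in blast)

end

lemma completely_simple_ideal_exists:
  assumes "sg_ideal K" "completely_simple K" shows "\<exists>e. completely_simple_ideal K e"
proof -
  obtain e where "e \<in> K" "idempotent e"
    and "\<forall>f\<in>K. idempotent f \<and> f = e * f \<and> f = f * e \<longrightarrow> f = e"
    using assms(2) unfolding completely_simple_def by blast
  then have "completely_simple_ideal K e"
    using assms by (intro completely_simple_ideal.intro) (auto simp: idempotent_def)
  then show ?thesis ..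
qed

theorem theorem1p1:
  fixes K :: "('a::semigroup_mult) set"
  assumes "sg_ideal K" and "completely_simple K"
  shows "(sg_solvable TYPE('a) \<longleftrightarrow>
            nilpotent_extension K \<and>
            (\<forall>H e. H \<subseteq> K \<and> group (sub_group_monoid H e) \<longrightarrow>
                   solvable (sub_group_monoid H e)))
       \<and> (sg_left_nilpotent TYPE('a) \<longleftrightarrow> sg_right_nilpotent TYPE('a))
       \<and> (sg_right_nilpotent TYPE('a) \<longleftrightarrow> sg_supernilpotent TYPE('a))
       \<and> (sg_supernilpotent TYPE('a) \<longleftrightarrow>
            nilpotent_extension K \<and>
            (\<forall>H e. H \<subseteq> K \<and> group (sub_group_monoid H e) \<longrightarrow>
                   nilpotent_group (sub_group_monoid H e)))"
proof -
  obtain e where "completely_simple_ideal K e"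
    using completely_simple_ideal_exists[OF assms] by blast
  then interpret completely_simple_ideal K e .
  have "sg_left_nilpotent TYPE('a) \<longleftrightarrow> nilpotent_extension K \<and> all_subgroups K nilpotent_group"
    unfolding sg_left_nilpotent_def by (rule central_series_eq_Id_iff[OF central_series_left_pow])
  moreover
  have "sg_right_nilpotent TYPE('a) \<longleftrightarrow> nilpotent_extension K \<and> all_subgroups K nilpotent_group"
    unfolding sg_right_nilpotent_def by (rule central_series_eq_Id_iff[OF central_series_right_pow])
  ultimately show ?thesis using sg_solvable_iff sg_supernilpotent_iff by blast
qed

end
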